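(* Every finite set of at least $7$ points in general position in $\mathbb{R}\mathcal{P}^2$ contains a projective $5$-hole. Also, $h_5^p(5)=1$ and $h_5^p(6)=0$.
   Context: A finite set of points in the real projective plane $\mathbb{R}\mathcal{P}^2$ is in general position if no three of its points lie on a common projective line. A Euclidean plane $\rho\subset\mathbb{R}\mathcal{P}^2$ is the set obtained by removing a projective line. A subset $X\subset\mathbb{R}\mathcal{P}^2$ is semiconvex if any two points of $X$ can be joined by a (projective) line segment contained in $X$; it is convex if it is semiconvex and contained in some Euclidean plane. A projective convex hull of $Y$ is an inclusion-wise minimal convex subset of $\mathbb{R}\mathcal{P}^2$ containing $Y$ (not necessarily unique). For a finite set $P\subset\mathbb{R}\mathcal{P}^2$ in general position, a projective $k$-gon determined by $P$ is a projective convex hull of a set $G$ of $k$ points of $P$ which contains all points of $G$ on its boundary; equivalently, a subset of $\mathbb{R}\mathcal{P}^2$ that is a convex polygon with $k$ vertices, all in $P$, in some Euclidean plane $\rho\subset\mathbb{R}\mathcal{P}^2$. A projective $k$-hole in $P$ ($k\ge3$) is a projective $k$-gon determined by $P$ with no point of $P$ in its interior. For $k\ge3$ and a positive integer $n$, $h_k^p(n)$ is the minimum number of projective $k$-holes in any set of $n$ points in $\mathbb{R}\mathcal{P}^2$ in general position. *)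

theory Defs
  imports "HOL-Analysis.Analysis"
begin

text \<open>Points of the real projective plane are the lines through the origin of \<open>\<real>\<^sup>3\<close>.\<close>

typedef rp2 = "{L :: (real ^ 3) set. subspace L \<and> dim L = 1}"
  morphisms carrier_line Abs_rp2
proof -
  obtain L :: "(real ^ 3) set" where "subspace L" "dim L = 1"
    using choose_subspace_of_subspace[of 1 "UNIV :: (real ^ 3) set"] by auto
  then show ?thesis by blast
qed

definition reps :: "rp2 \<Rightarrow> (real ^ 3) set" where
  "reps p = carrier_line p - {0}"

lemma reps_disjoint:
  assumes "v \<in> reps p" "v \<in> reps q"
  shows "p = q"
proof -
  have *: "span {v} = carrier_line r" if "v \<in> reps r" for r
  proof -
    have "subspace (carrier_line r)" "dim (carrier_line r) = 1"
      using carrier_line[of r] by auto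
    moreover have "v \<in> carrier_line r" "v \<noteq> 0" using that by (auto simp: reps_def)
    ultimately show ?thesis
      by (intro subspace_dim_equal) (use span_minimal[of "{v}"] in \<open>auto simp: dim_insert\<close>)
  qed
  show ?thesis using *[OF assms(1)] *[OF assms(2)] by (simp add: carrier_line_inject)
qed

text \<open>The quotient topology of \<open>\<real>\<^sup>3 - {0}\<close>.\<close>

instantiation rp2 :: topological_space
begin

definition open_rp2 :: "rp2 set \<Rightarrow> bool" where
  "open_rp2 U \<longleftrightarrow> open (\<Union>p\<in>U. reps p)"

instance
proof
  have "(\<Union>p. reps p) = - {0}"
  proof (intro equalityI subsetI)
    fix v :: "real ^ 3" assume v: "v \<in> - {0}"
    then have "span {v} \<in> {L. subspace L \<and> dim L = 1}" by (simp add: dim_insert)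
    then have "carrier_line (Abs_rp2 (span {v})) = span {v}" by (rule Abs_rp2_inverse)
    then have "v \<in> reps (Abs_rp2 (span {v}))" using v by (simp add: reps_def span_base)
    then show "v \<in> (\<Union>p. reps p)" by blast
  qed (auto simp: reps_def)
  then show "open (UNIV :: rp2 set)" by (simp add: open_rp2_def open_Compl)
next
  fix S T :: "rp2 set" assume "open S" "open T"
  moreover have "(\<Union>p\<in>S \<inter> T. reps p) = (\<Union>p\<in>S. reps p) \<inter> (\<Union>p\<in>T. reps p)"
    using reps_disjoint by blast
  ultimately show "open (S \<inter> T)" by (simp add: open_rp2_def open_Int)
next
  fix K :: "rp2 set set" assume "\<forall>S\<in>K. open S"
  moreover have "(\<Union>p\<in>\<Union>K. reps p) = (\<Union>S\<in>K. \<Union>p\<in>S. reps p)" by blast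
  ultimately show "open (\<Union>K)" by (auto simp: open_rp2_def)
qed

end

definition proj_line :: "rp2 set \<Rightarrow> bool" where
  "proj_line l \<longleftrightarrow> (\<exists>W. subspace W \<and> dim W = 2 \<and> l = {p. carrier_line p \<subseteq> W})"

definition general_position :: "rp2 set \<Rightarrow> bool" where
  "general_position P \<longleftrightarrow>
     \<not> (\<exists>l p q r. proj_line l \<and> {p, q, r} \<subseteq> P \<and> distinct [p, q, r] \<and> {p, q, r} \<subseteq> l)"

definition euclidean_plane :: "rp2 set \<Rightarrow> bool" where
  "euclidean_plane \<rho> \<longleftrightarrow> (\<exists>l. proj_line l \<and> \<rho> = - l)"

text \<open>Distinct points \<open>p\<close>, \<open>q\<close> are joined by two segments, the closed arcs of the line
  through them, corresponding to the relative sign of the representatives \<open>u\<close> and \<open>v\<close>.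
  The only segment joining \<open>p\<close> to itself is \<open>{p}\<close>.\<close>

definition proj_segment :: "rp2 \<Rightarrow> rp2 \<Rightarrow> rp2 set \<Rightarrow> bool" where
  "proj_segment p q S \<longleftrightarrow>
     (\<exists>u\<in>reps p. \<exists>v\<in>reps q. S = {x. \<exists>s\<ge>0. \<exists>t\<ge>0. s *\<^sub>R u + t *\<^sub>R v \<in> reps x})"

definition semiconvex :: "rp2 set \<Rightarrow> bool" where
  "semiconvex X \<longleftrightarrow> (\<forall>p\<in>X. \<forall>q\<in>X. \<exists>S. proj_segment p q S \<and> S \<subseteq> X)"

definition proj_convex :: "rp2 set \<Rightarrow> bool" where
  "proj_convex X \<longleftrightarrow> semiconvex X \<and> (\<exists>\<rho>. euclidean_plane \<rho> \<and> X \<subseteq> \<rho>)"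

definition proj_convex_hull :: "rp2 set \<Rightarrow> rp2 set \<Rightarrow> bool" where
  "proj_convex_hull Y H \<longleftrightarrow> proj_convex H \<and> Y \<subseteq> H \<and>
     (\<forall>X. proj_convex X \<and> Y \<subseteq> X \<and> X \<subseteq> H \<longrightarrow> X = H)"

definition proj_gon :: "nat \<Rightarrow> rp2 set \<Rightarrow> rp2 set \<Rightarrow> bool" where
  "proj_gon k P H \<longleftrightarrow>
     (\<exists>G. G \<subseteq> P \<and> finite G \<and> card G = k \<and> proj_convex_hull G H \<and> G \<subseteq> frontier H)"

definition proj_hole :: "nat \<Rightarrow> rp2 set \<Rightarrow> rp2 set \<Rightarrow> bool" where
  "proj_hole k P H \<longleftrightarrow> proj_gon k P H \<and> P \<inter> interior H = {}"

text \<open>Holes are counted as subsets of the plane: the same points may span several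
  of them. The finiteness condition only excludes the junk value of \<open>card\<close>.\<close>

definition min_proj_holes :: "nat \<Rightarrow> nat \<Rightarrow> nat" where
  "min_proj_holes k n = (LEAST m. \<exists>P. finite P \<and> card P = n \<and> general_position P \<and>
     finite {H. proj_hole k P H} \<and> card {H. proj_hole k P H} = m)"

end

theory Submission
  imports Defs
begin

text \<open>
  A point of the projective plane is represented by the nonzero vectors on a line through the origin,
  so statements about convex position become statements about signs of determinants. Five vectors
  are the vertices of a convex pentagon in counterclockwise order if all determinants of three of
  them in this order are positive. Signs are derived from each other by the Grassmann-Pluecker
  relation, in the form \<open>det3_between\<close>.

  Five points in general position have representatives of this kind (\<open>five_points_pent\<close>), unique
  up to a common sign (\<open>four_signs\<close>): after an odd number of sign changes among four vertices, one of
  them becomes a positive combination of the other three and leaves the boundary of the hull. So five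
  points determine exactly one pentagon, which contains none of them in its interior. If a sixth point lies in the core of
  a pentagon, the region bounded by its five diagonals, then the six points are arranged like the
  diagonals of a regular icosahedron: the pentagon of any five of them contains the sixth
  (\<open>pent_around\<close>). Such six points have no empty pentagon.

  For at least seven points the main step is \<open>two_inside_empty_pent\<close>: a convex pentagon that contains
  two or more of the given points also contains an empty pentagon spanned by these points and its
  vertices. Assume this and take any pentagon. If it contains a single point \<open>x\<close> in an ear, the
  triangle of three consecutive vertices, moving the middle vertex to \<open>x\<close> empties the pentagon.
  If \<open>x\<close> is in the core, a seventh point outside the pentagon lies in the pentagon around one of the
  vertices (\<open>six_cover\<close>), which thus contains two points, and the main step applies.

  The main step is proved by considering a minimal counterexample, the locale \<open>critical\<close>. There every
  other pentagon spanned by the points contains exactly one of them, in its core. Hence the interior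
  points all lie in the core of the given pentagon (\<open>not_in_ear\<close>), and each of the five diagonals has
  a nearest interior point, the same for lines turning about either end (\<open>nearest_exists\<close>). Diagonals
  with a common end have different nearest points, so at least three of the five nearest
  points are distinct. In each of the remaining cases two pentagons can be found such that the core
  point of one is a second interior point of the other.
\<close>

section \<open>Determinants of representatives\<close>

definition det3 :: "real ^ 3 \<Rightarrow> real ^ 3 \<Rightarrow> real ^ 3 \<Rightarrow> real" where
  "det3 a b c = a$1 * (b$2 * c$3 - b$3 * c$2) - a$2 * (b$1 * c$3 - b$3 * c$1)
     + a$3 * (b$1 * c$2 - b$2 * c$1)"

lemma det3_rotate: "det3 b c a = det3 a b c"
  by (simp add: det3_def algebra_simps)

lemma det3_rotate2: "det3 c a b = det3 a b c"
  by (simp add: det3_def algebra_simps)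

lemma det3_swap: "det3 b a c = - det3 a b c"
  by (simp add: det3_def algebra_simps)

lemma det3_minus [simp]:
  "det3 (- a) b c = det3 a c b" "det3 a (- b) c = det3 a c b" "det3 a b (- c) = det3 a c b"
  by (simp_all add: det3_def algebra_simps)

lemma det3_same [simp]: "det3 a a b = 0" "det3 a b a = 0" "det3 b a a = 0"
  by (simp_all add: det3_def algebra_simps)

lemma det3_add: "det3 a b (x + y) = det3 a b x + det3 a b y"
  by (simp add: det3_def algebra_simps)

lemma det3_scale: "det3 a b (r *\<^sub>R x) = r * det3 a b x"
  by (simp add: det3_def algebra_simps)

lemma det3_diff: "det3 a b (x - y) = det3 a b x - det3 a b y"
  by (simp add: det3_def algebra_simps)

lemmas det3_linear = det3_add det3_scale det3_diff

lemma grassmann_pluecker: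
  "det3 x b d * det3 x c e = det3 x b c * det3 x d e + det3 x b e * det3 x c d"
  by (simp add: det3_def algebra_simps)

text \<open>Seen from \<open>x\<close>, the vectors \<open>b, c, d, e\<close> turn counterclockwise and stay in a half-plane, so both
  products on one side of the Grassmann-Pluecker relation are positive, and with them the product on
  the other side. Most sign arguments below are chains of applications of this rule; a vector on the
  wrong side of the half-plane is replaced by its negative.\<close>
lemma det3_between:
  assumes "0 < det3 x b c" "0 < det3 x d e" "0 < det3 x b e" "0 < det3 x c d" "0 < det3 x c e"
  shows "0 < det3 x b d"
proof -
  have "0 < det3 x b d * det3 x c e"
    unfolding grassmann_pluecker[of x b d c e] by (intro add_pos_pos mult_pos_pos assms)
  then show ?thesis using assms(5) by (simp add: zero_less_mult_iff)
qed

lemma cramer: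
  "det3 a b c *\<^sub>R v = det3 b c v *\<^sub>R a + det3 c a v *\<^sub>R b + det3 a b v *\<^sub>R c"
  by (simp add: vec_eq_iff forall_3 det3_def algebra_simps)

section \<open>Convex pentagons as tuples of representatives\<close>

text \<open>Vertices of a convex pentagon in counterclockwise order, given by representatives that lie on one
  side of some plane through the origin. This is the alternating oriented matroid of rank 3.\<close>
definition pent :: "real ^ 3 \<Rightarrow> real ^ 3 \<Rightarrow> real ^ 3 \<Rightarrow> real ^ 3 \<Rightarrow> real ^ 3 \<Rightarrow> bool" where
  "pent a b c d e \<longleftrightarrow>
     0 < det3 a b c \<and> 0 < det3 a b d \<and> 0 < det3 a b e \<and> 0 < det3 a c d \<and> 0 < det3 a c e \<and>
     0 < det3 a d e \<and> 0 < det3 b c d \<and> 0 < det3 b c e \<and> 0 < det3 b d e \<and> 0 < det3 c d e"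

definition pent_int :: "real ^ 3 \<Rightarrow> real ^ 3 \<Rightarrow> real ^ 3 \<Rightarrow> real ^ 3 \<Rightarrow> real ^ 3 \<Rightarrow> real ^ 3 \<Rightarrow> bool" where
  "pent_int a b c d e v \<longleftrightarrow>
     0 < det3 a b v \<and> 0 < det3 b c v \<and> 0 < det3 c d v \<and> 0 < det3 d e v \<and> 0 < det3 e a v"

definition pent_cl :: "real ^ 3 \<Rightarrow> real ^ 3 \<Rightarrow> real ^ 3 \<Rightarrow> real ^ 3 \<Rightarrow> real ^ 3 \<Rightarrow> real ^ 3 \<Rightarrow> bool" where
  "pent_cl a b c d e v \<longleftrightarrow>
     0 \<le> det3 a b v \<and> 0 \<le> det3 b c v \<and> 0 \<le> det3 c d v \<and> 0 \<le> det3 d e v \<and> 0 \<le> det3 e a v"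

text \<open>The core is the small pentagon bounded by the five diagonals. An ear, the triangle of three
  consecutive vertices, is what a single diagonal cuts off.\<close>
definition pent_core :: "real ^ 3 \<Rightarrow> real ^ 3 \<Rightarrow> real ^ 3 \<Rightarrow> real ^ 3 \<Rightarrow> real ^ 3 \<Rightarrow> real ^ 3 \<Rightarrow> bool" where
  "pent_core a b c d e v \<longleftrightarrow>
     0 < det3 a c v \<and> 0 < det3 b d v \<and> 0 < det3 c e v \<and> 0 < det3 d a v \<and> 0 < det3 e b v"

lemma det3_posD:
  assumes "0 < det3 a b c"
  shows "0 < det3 a b c \<and> 0 < det3 b c a \<and> 0 < det3 c a b"
  using assms by (simp add: det3_rotate det3_rotate2)

text \<open>All cyclic rotations of the ten determinants are listed, so that a simplifier call can check the
  premises of \<open>det3_between\<close> whatever the order in which they name the vertices.\<close>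
lemma pentD:
  assumes "pent a b c d e"
  shows "0 < det3 a b c \<and> 0 < det3 a b d \<and> 0 < det3 a b e \<and> 0 < det3 a c d \<and> 0 < det3 a c e \<and>
     0 < det3 a d e \<and> 0 < det3 b c d \<and> 0 < det3 b c e \<and> 0 < det3 b d e \<and> 0 < det3 c d e \<and>
     0 < det3 b c a \<and> 0 < det3 b d a \<and> 0 < det3 b e a \<and> 0 < det3 c d a \<and> 0 < det3 c e a \<and>
     0 < det3 d e a \<and> 0 < det3 c d b \<and> 0 < det3 c e b \<and> 0 < det3 d e b \<and> 0 < det3 d e c \<and>
     0 < det3 c a b \<and> 0 < det3 d a b \<and> 0 < det3 e a b \<and> 0 < det3 d a c \<and> 0 < det3 e a c \<and>
     0 < det3 e a d \<and> 0 < det3 d b c \<and> 0 < det3 e b c \<and> 0 < det3 e b d \<and> 0 < det3 e c d"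
  using assms by (simp add: pent_def det3_rotate det3_rotate2)

lemma pent_intD:
  assumes "pent_int a b c d e v"
  shows "0 < det3 a b v \<and> 0 < det3 b c v \<and> 0 < det3 c d v \<and> 0 < det3 d e v \<and> 0 < det3 e a v \<and>
     0 < det3 b v a \<and> 0 < det3 c v b \<and> 0 < det3 d v c \<and> 0 < det3 e v d \<and> 0 < det3 a v e \<and>
     0 < det3 v a b \<and> 0 < det3 v b c \<and> 0 < det3 v c d \<and> 0 < det3 v d e \<and> 0 < det3 v e a"
  using assms by (simp add: pent_int_def det3_rotate det3_rotate2)

lemma pent_coreD:
  assumes "pent_core a b c d e v"
  shows "0 < det3 a c v \<and> 0 < det3 b d v \<and> 0 < det3 c e v \<and> 0 < det3 d a v \<and> 0 < det3 e b v \<and>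
     0 < det3 c v a \<and> 0 < det3 d v b \<and> 0 < det3 e v c \<and> 0 < det3 a v d \<and> 0 < det3 b v e \<and>
     0 < det3 v a c \<and> 0 < det3 v b d \<and> 0 < det3 v c e \<and> 0 < det3 v d a \<and> 0 < det3 v e b"
  using assms by (simp add: pent_core_def det3_rotate det3_rotate2)

lemma pent_rotate: "pent a b c d e \<Longrightarrow> pent b c d e a"
  by (drule pentD) (simp add: pent_def)

lemma pent_int_rotate: "pent_int a b c d e v \<Longrightarrow> pent_int b c d e a v"
  by (simp add: pent_int_def)

lemma pent_core_rotate: "pent_core a b c d e v \<Longrightarrow> pent_core b c d e a v"
  by (simp add: pent_core_def)

lemma pent_int_imp_cl: "pent_int a b c d e v \<Longrightarrow> pent_cl a b c d e v"
  by (simp add: pent_int_def pent_cl_def)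

lemma pent_vertices_cl:
  assumes "pent a b c d e"
  shows "pent_cl a b c d e a" "pent_cl a b c d e b" "pent_cl a b c d e c" "pent_cl a b c d e d" "pent_cl a b c d e e"
  using pentD[OF assms] by (simp_all add: pent_cl_def less_imp_le)

section \<open>Cones spanned by the vertices\<close>

lemma triangle_comb:
  assumes "0 < det3 a b c" "0 \<le> det3 b c v" "0 \<le> det3 c a v" "0 \<le> det3 a b v"
  obtains x y z where "0 \<le> x" "0 \<le> y" "0 \<le> z" "v = x *\<^sub>R a + y *\<^sub>R b + z *\<^sub>R c"
proof
  let ?D = "det3 a b c"
  show "v = (det3 b c v / ?D) *\<^sub>R a + (det3 c a v / ?D) *\<^sub>R b + (det3 a b v / ?D) *\<^sub>R c"
  proof -
    have "v = (1 / ?D) *\<^sub>R (?D *\<^sub>R v)" using assms(1) by simp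
    also have "\<dots> = (det3 b c v / ?D) *\<^sub>R a + (det3 c a v / ?D) *\<^sub>R b + (det3 a b v / ?D) *\<^sub>R c"
      unfolding cramer[of a b c v] by (simp add: scaleR_add_right)
    finally show ?thesis .
  qed
qed (use assms in auto)

text \<open>A diagonal splits the quadrilateral into two triangles.\<close>
lemma quad_comb:
  assumes "0 < det3 b c d" "0 < det3 b d e"
    and "0 \<le> det3 b c v" "0 \<le> det3 c d v" "0 \<le> det3 d e v" "0 \<le> det3 e b v"
  obtains y z t u where "0 \<le> y" "0 \<le> z" "0 \<le> t" "0 \<le> u"
    "v = y *\<^sub>R b + z *\<^sub>R c + t *\<^sub>R d + u *\<^sub>R e"
proof (cases "0 \<le> det3 d b v")
  case True
  obtain x y z where "0 \<le> x" "0 \<le> y" "0 \<le> z" "v = x *\<^sub>R b + y *\<^sub>R c + z *\<^sub>R d"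
    using triangle_comb[OF assms(1,4) True assms(3)] by blast
  then show ?thesis using that[of x y z 0] by simp
next
  case False
  then have "0 \<le> det3 b d v" using det3_swap[of b d v] by simp
  then obtain x y z where "0 \<le> x" "0 \<le> y" "0 \<le> z" "v = x *\<^sub>R b + y *\<^sub>R d + z *\<^sub>R e"
    using triangle_comb[OF assms(2,5,6)] by blast
  then show ?thesis using that[of x 0 y z] by simp
qed

lemma pent_comb:
  assumes "pent a b c d e" "pent_cl a b c d e v"
  obtains x y z t u where "0 \<le> x" "0 \<le> y" "0 \<le> z" "0 \<le> t" "0 \<le> u"
    "v = x *\<^sub>R a + y *\<^sub>R b + z *\<^sub>R c + t *\<^sub>R d + u *\<^sub>R e"
proof -
  note H = pentD[OF assms(1)] and K = assms(2)[unfolded pent_cl_def]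
  show ?thesis
  proof (cases "0 \<le> det3 e b v")
    case True
    obtain y z t u where "0 \<le> y" "0 \<le> z" "0 \<le> t" "0 \<le> u"
      "v = y *\<^sub>R b + z *\<^sub>R c + t *\<^sub>R d + u *\<^sub>R e"
      by (rule quad_comb[of b c d e v]) (use H K True in auto)
    then show ?thesis using that[of 0 y z t u] by simp
  next
    case False
    then have be: "0 \<le> det3 b e v" using det3_swap[of b e v] by simp
    obtain x y z where "0 \<le> x" "0 \<le> y" "0 \<le> z" "v = x *\<^sub>R a + y *\<^sub>R b + z *\<^sub>R e"
      by (rule triangle_comb[of a b e v]) (use H K be in auto)
    then show ?thesis using that[of x y 0 0 z] by simp
  qed
qed

text \<open>This lets an interior point be moved a little towards the boundary without leaving the interior.\<close>
lemma small_common_step: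
  fixes xs :: "(real \<times> real) list"
  assumes "\<forall>(x, y)\<in>set xs. 0 < x"
  obtains r where "0 < r" "\<forall>(x, y)\<in>set xs. 0 < x - r * y"
  using assms
proof (induction xs arbitrary: thesis)
  case Nil
  then show ?case using zero_less_one by (metis empty_iff empty_set)
next
  case (Cons p xs)
  obtain x y where p: "p = (x, y)" by fastforce
  have x: "0 < x" using Cons.prems(2) p by auto
  obtain r where r: "0 < r" "\<forall>(x, y)\<in>set xs. 0 < x - r * y"
    using Cons.IH Cons.prems(2) by auto
  define s where "s = min r (x / (2 * (\<bar>y\<bar> + 1)))"
  have s: "0 < s" "s \<le> r" using r x by (auto simp: s_def)
  have "s * y \<le> s * (\<bar>y\<bar> + 1)" using s by (intro mult_left_mono) auto
  also have "\<dots> \<le> (x / (2 * (\<bar>y\<bar> + 1))) * (\<bar>y\<bar> + 1)"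
    by (intro mult_right_mono) (auto simp: s_def)
  also have "\<dots> = x / 2" by (simp add: field_simps)
  finally have 1: "0 < x - s * y" using x by simp
  have 2: "0 < x' - s * y'" if "(x', y') \<in> set xs" for x' y'
  proof (cases "0 \<le> y'")
    case True
    then have "s * y' \<le> r * y'" using s by (intro mult_right_mono) auto
    then show ?thesis using r that by fastforce
  next
    case False
    then have "s * y' < 0" using s by (simp add: mult_pos_neg)
    moreover have "0 < x'" using Cons.prems(2) that by auto
    ultimately show ?thesis by simp
  qed
  show ?case using Cons.prems(1)[of s] s 1 2 p by auto
qed

text \<open>A linear functional that is nonnegative on the five vectors and vanishes on a combination with
  positive coefficients at \<open>b, c, d\<close> vanishes on a basis, hence everywhere.\<close>
lemma strict_inside:
  assumes q: "pent q1 q2 q3 q4 q5" and D: "0 < det3 b c d"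
    and c: "pent_cl q1 q2 q3 q4 q5 a" "pent_cl q1 q2 q3 q4 q5 b" "pent_cl q1 q2 q3 q4 q5 c"
      "pent_cl q1 q2 q3 q4 q5 d" "pent_cl q1 q2 q3 q4 q5 e"
    and pos: "0 \<le> x" "0 < y" "0 < z" "0 < t" "0 < u"
    and v: "v = x *\<^sub>R a + y *\<^sub>R b + z *\<^sub>R c + t *\<^sub>R d + u *\<^sub>R e"
  shows "pent_int q1 q2 q3 q4 q5 v"
proof -
  have *: "0 < det3 f g v" if f: "0 \<le> det3 f g a" "0 \<le> det3 f g b" "0 \<le> det3 f g c"
      "0 \<le> det3 f g d" "0 \<le> det3 f g e" and h: "0 < det3 f g h" for f g h
  proof -
    have *: "det3 f g v = x * det3 f g a + y * det3 f g b + z * det3 f g c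
        + t * det3 f g d + u * det3 f g e"
      by (simp add: v det3_linear)
    have "det3 b c d * det3 f g h = det3 f g (det3 b c d *\<^sub>R h)" by (simp add: det3_linear)
    also have "\<dots> = det3 c d h * det3 f g b + det3 d b h * det3 f g c + det3 b c h * det3 f g d"
      unfolding cramer[of b c d h] by (simp add: det3_linear)
    finally have "\<not> (det3 f g b = 0 \<and> det3 f g c = 0 \<and> det3 f g d = 0)"
      using D h by auto
    then have "0 < det3 f g b \<or> 0 < det3 f g c \<or> 0 < det3 f g d" using f by auto
    moreover have "0 \<le> x * det3 f g a" "0 \<le> y * det3 f g b" "0 \<le> z * det3 f g c"
      "0 \<le> t * det3 f g d" "0 \<le> u * det3 f g e" using f pos by auto
    moreover have "0 < det3 f g b \<Longrightarrow> 0 < y * det3 f g b" "0 < det3 f g c \<Longrightarrow> 0 < z * det3 f g c"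
      "0 < det3 f g d \<Longrightarrow> 0 < t * det3 f g d" using pos by auto
    ultimately show ?thesis unfolding * by linarith
  qed
  note H = pentD[OF q]
  show ?thesis unfolding pent_int_def
    using *[of q1 q2 q3] *[of q2 q3 q4] *[of q3 q4 q5] *[of q4 q5 q1] *[of q5 q1 q2] c H
    unfolding pent_cl_def by auto
qed

text \<open>Subtracting a small multiple of the sum of the vertices keeps \<open>v\<close> in the pentagon, so \<open>v\<close> is a
  combination of the vertices with all five coefficients positive.\<close>
lemma pent_int_mono:
  assumes q: "pent q1 q2 q3 q4 q5" and w: "pent a b c d e"
    and c: "pent_cl q1 q2 q3 q4 q5 a" "pent_cl q1 q2 q3 q4 q5 b" "pent_cl q1 q2 q3 q4 q5 c"
      "pent_cl q1 q2 q3 q4 q5 d" "pent_cl q1 q2 q3 q4 q5 e"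
    and v: "pent_int a b c d e v"
  shows "pent_int q1 q2 q3 q4 q5 v"
proof -
  define s where "s = a + b + c + d + e"
  obtain r where r: "0 < r" "\<forall>(x, y)\<in>set [(det3 a b v, det3 a b s), (det3 b c v, det3 b c s),
      (det3 c d v, det3 c d s), (det3 d e v, det3 d e s), (det3 e a v, det3 e a s)]. 0 < x - r * y"
    using small_common_step[of "[(det3 a b v, det3 a b s), (det3 b c v, det3 b c s),
      (det3 c d v, det3 c d s), (det3 d e v, det3 d e s), (det3 e a v, det3 e a s)]"] v
    unfolding pent_int_def by auto
  have "pent_cl a b c d e (v - r *\<^sub>R s)"
    using r(2) by (simp add: pent_cl_def det3_linear less_imp_le)
  then obtain x y z t u where xs: "0 \<le> x" "0 \<le> y" "0 \<le> z" "0 \<le> t" "0 \<le> u"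
    and eq: "v - r *\<^sub>R s = x *\<^sub>R a + y *\<^sub>R b + z *\<^sub>R c + t *\<^sub>R d + u *\<^sub>R e"
    using pent_comb[OF w] by blast
  have "v = (v - r *\<^sub>R s) + r *\<^sub>R s" by simp
  also have "\<dots> = (x + r) *\<^sub>R a + (y + r) *\<^sub>R b + (z + r) *\<^sub>R c + (t + r) *\<^sub>R d + (u + r) *\<^sub>R e"
    unfolding eq by (simp add: s_def algebra_simps)
  finally show ?thesis
    using strict_inside[OF q _ c, of "x + r" "y + r" "z + r" "t + r" "u + r" v] pentD[OF w] xs r(1)
    by simp
qed

text \<open>An interior point outside the ear of \<open>a\<close> lies in the quadrilateral of the other four vertices,
  and this quadrilateral is contained in the larger pentagon.\<close>
lemma pent_int_mono_quad:
  assumes q: "pent q1 q2 q3 q4 q5" and w: "pent a b c d e"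
    and c: "pent_cl q1 q2 q3 q4 q5 b" "pent_cl q1 q2 q3 q4 q5 c" "pent_cl q1 q2 q3 q4 q5 d" "pent_cl q1 q2 q3 q4 q5 e"
    and v: "pent_int a b c d e v" "0 < det3 e b v"
  shows "pent_int q1 q2 q3 q4 q5 v"
proof -
  define s where "s = b + c + d + e"
  obtain r where r: "0 < r" "\<forall>(x, y)\<in>set [(det3 b c v, det3 b c s),
      (det3 c d v, det3 c d s), (det3 d e v, det3 d e s), (det3 e b v, det3 e b s)]. 0 < x - r * y"
    using small_common_step[of "[(det3 b c v, det3 b c s),
      (det3 c d v, det3 c d s), (det3 d e v, det3 d e s), (det3 e b v, det3 e b s)]"] v
    unfolding pent_int_def by auto
  have nn: "0 \<le> det3 b c (v - r *\<^sub>R s)" "0 \<le> det3 c d (v - r *\<^sub>R s)"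
    "0 \<le> det3 d e (v - r *\<^sub>R s)" "0 \<le> det3 e b (v - r *\<^sub>R s)"
    using r(2) by (simp_all add: det3_linear less_imp_le)
  obtain y z t u where xs: "0 \<le> y" "0 \<le> z" "0 \<le> t" "0 \<le> u"
    and eq: "v - r *\<^sub>R s = y *\<^sub>R b + z *\<^sub>R c + t *\<^sub>R d + u *\<^sub>R e"
    by (rule quad_comb[of b c d e "v - r *\<^sub>R s"]) (use pentD[OF w] nn in auto)
  have "v = (v - r *\<^sub>R s) + r *\<^sub>R s" by simp
  also have "\<dots> = 0 *\<^sub>R b + (y + r) *\<^sub>R b + (z + r) *\<^sub>R c + (t + r) *\<^sub>R d + (u + r) *\<^sub>R e"
    unfolding eq by (simp add: s_def algebra_simps)
  finally show ?thesis
    using strict_inside[OF q _ c(1,1,2,3,4), of 0 "y + r" "z + r" "t + r" "u + r" v] pentD[OF w] xs r(1)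
    by simp
qed

section \<open>Emptying the ear of a pentagon\<close>

definition general_pos :: "(real ^ 3) set \<Rightarrow> bool" where
  "general_pos S \<longleftrightarrow> (\<forall>a\<in>S. \<forall>b\<in>S. \<forall>c\<in>S. distinct [a, b, c] \<longrightarrow> det3 a b c \<noteq> 0)"

text \<open>The vertices may come from a larger set than the points that have to be avoided, since a
  pentagon and the points inside it play different roles in the induction.\<close>
definition empty_pent :: "(real ^ 3) set \<Rightarrow> (real ^ 3) set \<Rightarrow> bool" where
  "empty_pent V I \<longleftrightarrow> (\<exists>a b c d e. {a, b, c, d, e} \<subseteq> V \<and> pent a b c d e \<and> (\<forall>v\<in>I. \<not> pent_int a b c d e v))"

lemma general_pos_swap:
  assumes "general_pos S" "a \<in> S" "b \<in> S" "c \<in> S" "distinct [a, b, c]" "\<not> 0 < det3 a b c"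
  shows "0 < det3 b a c"
proof -
  have "det3 a b c \<noteq> 0" using assms unfolding general_pos_def by blast
  then show ?thesis using assms(6) det3_swap[of a b c] by simp
qed

lemma pent_replace_ear:
  assumes "pent p1 p2 p3 p4 p5" "pent_int p1 p2 p3 p4 p5 z" "0 < det3 p5 z p2"
  shows "pent z p2 p3 p4 p5"
proof -
  note H = pentD[OF assms(1)] pent_intD[OF assms(2)] det3_posD[OF assms(3)]
  have "0 < det3 p2 p4 z" by (rule det3_between[of p2 p4 p5 z p1]) (simp_all add: H)
  note H = H det3_posD[OF this]
  have "0 < det3 p5 z p3" by (rule det3_between[of p5 p3 "- p1" "- z" "- p2", simplified]) (simp_all add: H)
  note H = H det3_posD[OF this]
  show ?thesis unfolding pent_def by (simp add: H)
qed

text \<open>If all interior points lie in the ear of \<open>a\<close>, moving \<open>a\<close> to one of them gives a smaller pentagon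
  with the same property and fewer interior points.\<close>
lemma empty_pent_of_ear:
  assumes fin: "finite I" and p: "pent a b c d e" "{a, b, c, d, e} \<subseteq> V" "I \<subseteq> V"
    and ear: "\<And>v. v \<in> I \<Longrightarrow> pent_int a b c d e v \<Longrightarrow> 0 < det3 e v b"
  shows "empty_pent V I"
  using p ear
proof (induction "card {v \<in> I. pent_int a b c d e v}" arbitrary: a rule: less_induct)
  case less
  show ?case
  proof (cases "\<exists>z\<in>I. pent_int a b c d e z")
    case False
    then show ?thesis using less.prems unfolding empty_pent_def by blast
  next
    case True
    then obtain z where z: "z \<in> I" "pent_int a b c d e z" by blast
    have q: "pent z b c d e" using pent_replace_ear[OF less.prems(1) z(2)] less.prems(4) z by blast
    have sub: "pent_int a b c d e v" if "pent_int z b c d e v" for v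
      by (rule pent_int_mono[OF less.prems(1) q _ _ _ _ _ that])
        (use pent_vertices_cl[OF less.prems(1)] pent_int_imp_cl[OF z(2)] in auto)
    have "\<not> pent_int z b c d e z" by (simp add: pent_int_def)
    then have "{v \<in> I. pent_int z b c d e v} \<subset> {v \<in> I. pent_int a b c d e v}"
      using sub z by blast
    then have "card {v \<in> I. pent_int z b c d e v} < card {v \<in> I. pent_int a b c d e v}"
      using fin by (simp add: psubset_card_mono)
    then show ?thesis
      using less.hyps[of z] q sub less.prems z(1) by (simp add: subset_iff)
  qed
qed

section \<open>Pentagons with two interior points\<close>

text \<open>The situation in a minimal counterexample to the existence of an empty pentagon: every pentagon
  spanned by the vertices and the points of \<open>I\<close>, with at least one vertex in \<open>I\<close>, contains exactly one
  point of \<open>I\<close>. It lies in the core, because otherwise all interior points would lie in one ear.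
  The aim is to show that \<open>I\<close> then has at most one element.\<close>
locale critical =
  fixes p1 p2 p3 p4 p5 :: "real ^ 3" and I
  assumes pent: "pent p1 p2 p3 p4 p5"
    and finite: "finite I"
    and inside: "z \<in> I \<Longrightarrow> pent_int p1 p2 p3 p4 p5 z"
    and general: "general_pos ({p1, p2, p3, p4, p5} \<union> I)"
    and unique: "pent a b c d e \<Longrightarrow> {a, b, c, d, e} \<subseteq> {p1, p2, p3, p4, p5} \<union> I \<Longrightarrow> {a, b, c, d, e} \<inter> I \<noteq> {} \<Longrightarrow>
      \<exists>z. {v \<in> I. pent_int a b c d e v} = {z} \<and> pent_core a b c d e z"

context critical
begin

lemma rotate: "critical p2 p3 p4 p5 p1 I"
proof -
  have *: "{p2, p3, p4, p5, p1} = {p1, p2, p3, p4, p5}" by auto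
  show ?thesis
    unfolding critical_def *
    using pent_rotate[OF pent] finite pent_int_rotate[OF inside] general unique by blast
qed

lemma not_vertex: "z \<in> I \<Longrightarrow> z \<notin> {p1, p2, p3, p4, p5}"
  using inside[of z] by (auto simp: pent_int_def)

lemma swap:
  assumes "\<not> 0 < det3 a b c" "distinct [a, b, c]" "{a, b, c} \<subseteq> {p1, p2, p3, p4, p5} \<union> I"
  shows "0 < det3 b a c"
  using general_pos_swap[OF general _ _ _ assms(2,1)] assms(3) by auto

lemma uniqueE:
  assumes "pent a b c d e" "{a, b, c, d, e} \<subseteq> {p1, p2, p3, p4, p5} \<union> I" "{a, b, c, d, e} \<inter> I \<noteq> {}"
  obtains z where "z \<in> I" "pent_int a b c d e z" "pent_core a b c d e z" "{v \<in> I. pent_int a b c d e v} = {z}"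
proof -
  obtain z where z: "{v \<in> I. pent_int a b c d e v} = {z}" "pent_core a b c d e z"
    using unique[OF assms] by blast
  then have "z \<in> I" "pent_int a b c d e z" by blast+
  then show ?thesis using that z by blast
qed

text \<open>Replacing \<open>p1\<close> by a point \<open>y\<close> of its ear leaves a pentagon with a single interior point \<open>x\<close>, in its
  core. The line \<open>x y\<close> leaves \<open>p2, p3\<close> on one side and \<open>p4, p5\<close> on the other. On the side of \<open>p1\<close>,
  the three vertices together with \<open>x\<close> and \<open>y\<close> form a pentagon whose core point would be a second
  interior point of the pentagon with vertex \<open>y\<close>.\<close>
lemma not_in_ear:
  assumes y: "y \<in> I"
  shows "\<not> 0 < det3 p5 y p2"
proof
  assume ear: "0 < det3 p5 y p2"
  have Y: "pent y p2 p3 p4 p5" by (rule pent_replace_ear[OF pent inside[OF y] ear])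
  obtain x where x: "x \<in> I" "pent_int y p2 p3 p4 p5 x" "pent_core y p2 p3 p4 p5 x"
    and ux: "{v \<in> I. pent_int y p2 p3 p4 p5 v} = {x}"
    by (rule uniqueE[OF Y]) (use y in blast)+
  have xy: "x \<noteq> y" using x(2) by (auto simp: pent_int_def)
  note H = pentD[OF pent] pent_intD[OF inside[OF y]] pent_intD[OF inside[OF x(1)]] det3_posD[OF ear]
    pent_intD[OF x(2)] pent_coreD[OF x(3)] pentD[OF Y]
  have cl: "pent_cl y p2 p3 p4 p5 x" using pent_int_imp_cl[OF x(2)] .
  note cls = pent_vertices_cl[OF Y]
  show False
  proof (cases "0 < det3 x y p1")
    case True
    note H = H det3_posD[OF True]
    have "0 < det3 x p1 p3" by (rule det3_between[of x p1 p2 p3 "- y", simplified]) (simp_all add: H)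
    note H = H det3_posD[OF this]
    have "0 < det3 y p1 p3" by (rule det3_between[of y p1 p2 p3 x]) (simp_all add: H)
    note H = H det3_posD[OF this]
    have Q: "pent p1 p2 p3 x y" unfolding pent_def by (simp add: H)
    obtain v where v: "v \<in> I" "pent_int p1 p2 p3 x y v" "pent_core p1 p2 p3 x y v"
      by (rule uniqueE[OF Q]) (use x(1) y in blast)+
    have "pent_int y p2 p3 p4 p5 v"
      by (rule pent_int_mono_quad[OF Y Q cls(2,3) cl cls(1) v(2)]) (use v(3) in \<open>simp add: pent_core_def\<close>)
    then have "v = x" using ux v(1) by auto
    then show False using v(2) by (simp add: pent_int_def)
  next
    case False
    have "0 < det3 y x p1"
      by (rule swap[OF False]) (use xy not_vertex[OF x(1)] not_vertex[OF y] x(1) y in simp_all)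
    note H = H det3_posD[OF this]
    have "0 < det3 x p4 p1" by (rule det3_between[of x p1 y "- p4" p2, simplified]) (simp_all add: H)
    note H = H det3_posD[OF this]
    have "0 < det3 y p4 p1" by (rule det3_between[of y p1 "- x" "- p4" "- p5", simplified]) (simp_all add: H)
    note H = H det3_posD[OF this]
    have Q: "pent p1 y x p4 p5" unfolding pent_def by (simp add: H)
    obtain v where v: "v \<in> I" "pent_int p1 y x p4 p5 v" "pent_core p1 y x p4 p5 v"
      by (rule uniqueE[OF Q]) (use x(1) y in blast)+
    have "pent_int y p2 p3 p4 p5 v"
      by (rule pent_int_mono_quad[OF Y Q cls(1) cl cls(4,5) v(2)]) (use v(3) in \<open>simp add: pent_core_def\<close>)
    then have "v = x" using ux v(1) by auto
    then show False using v(2) by (simp add: pent_int_def)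
  qed
qed

end

lemma (in critical) all_in_core:
  assumes "z \<in> I"
  shows "pent_core p1 p2 p3 p4 p5 z"
proof -
  interpret r2: critical p2 p3 p4 p5 p1 I by (rule rotate)
  interpret r3: critical p3 p4 p5 p1 p2 I by (rule r2.rotate)
  interpret r4: critical p4 p5 p1 p2 p3 I by (rule r3.rotate)
  interpret r5: critical p5 p1 p2 p3 p4 I by (rule r4.rotate)
  have d: "distinct [p1, p2, p3, p4, p5]" "p5 \<noteq> p2" "p4 \<noteq> p1"
    using pent by (auto simp: pent_def)
  have sw: "0 < det3 a b z" if "\<not> 0 < det3 a z b" "{a, b} \<subseteq> {p1, p2, p3, p4, p5}" "a \<noteq> b" for a b
  proof -
    have "z \<noteq> a" "z \<noteq> b" using not_vertex[OF assms] that(2) by blast+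
    then have "0 < det3 z a b" using swap[OF that(1)] that(2,3) assms by auto
    then show ?thesis using det3_posD by blast
  qed
  show ?thesis unfolding pent_core_def
    using sw[OF not_in_ear[OF assms]] sw[OF r2.not_in_ear[OF assms]] sw[OF r3.not_in_ear[OF assms]]
      sw[OF r4.not_in_ear[OF assms]] sw[OF r5.not_in_ear[OF assms]] d by simp
qed

text \<open>The point \<open>m\<close> is the nearest point of \<open>I\<close> to the diagonal \<open>p q\<close>, both for a line turning about \<open>p\<close>
  and for a line turning about \<open>q\<close>. All other points of \<open>I\<close> lie in the cone opposite to the
  angle \<open>p m q\<close>.\<close>
definition nearest :: "(real ^ 3) set \<Rightarrow> real ^ 3 \<Rightarrow> real ^ 3 \<Rightarrow> real ^ 3 \<Rightarrow> bool" where
  "nearest I p q m \<longleftrightarrow> m \<in> I \<and> (\<forall>z\<in>I. z \<noteq> m \<longrightarrow> 0 < det3 p m z \<and> 0 < det3 q z m)"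

text \<open>Let \<open>b\<close> be the first point of \<open>I\<close> for a line turning about \<open>p3\<close>. If some \<open>z\<close> came before \<open>b\<close> for a
  line turning about \<open>p1\<close>, then \<open>p1 p2 p3 z b\<close> would be a pentagon, and by the choice of \<open>b\<close> all its
  interior points would lie in the ear of \<open>z\<close>.\<close>
lemma (in critical) nearest_exists:
  assumes "I \<noteq> {}"
  shows "\<exists>m. nearest I p1 p3 m"
proof -
  \<comment> \<open>The quotient is a monotone coordinate on the pencil of lines through \<open>p3\<close>, so its
    maximum belongs to the first point met when the line \<open>p3 p1\<close> turns about \<open>p3\<close>.\<close>
  define f where "f z = det3 p3 p4 z / det3 p2 p3 z" for z
  obtain b where b: "b \<in> I" "\<And>z. z \<in> I \<Longrightarrow> f z \<le> f b"
  proof -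
    have "finite (f ` I)" "f ` I \<noteq> {}" using finite assms by auto
    then obtain b where "b \<in> I" "f b = Max (f ` I)" using Max_in by (metis imageE)
    then show ?thesis using that[of b] \<open>finite (f ` I)\<close> by simp
  qed
  have first: "0 < det3 p3 z b" if z: "z \<in> I" "z \<noteq> b" for z
  proof -
    have i: "0 < det3 p2 p3 z" "0 < det3 p2 p3 b"
      using inside[OF z(1)] inside[OF b(1)] by (auto simp: pent_int_def)
    have "det3 p3 p4 z * det3 p2 p3 b \<le> det3 p3 p4 b * det3 p2 p3 z"
      using b(2)[OF z(1)] i by (simp add: f_def field_simps)
    moreover have "det3 p3 p4 b * det3 p2 p3 z - det3 p3 p4 z * det3 p2 p3 b = det3 p2 p3 p4 * det3 p3 z b"
      by (simp add: det3_def algebra_simps)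
    moreover have "0 < det3 p2 p3 p4" using pent by (simp add: pent_def)
    ultimately have "0 \<le> det3 p2 p3 p4 * det3 p3 z b" "0 < det3 p2 p3 p4" by linarith+
    then have "0 \<le> det3 p3 z b" by (simp add: zero_le_mult_iff)
    show ?thesis
    proof (rule ccontr)
      assume "\<not> ?thesis"
      then have "0 < det3 z p3 b"
        by (rule swap) (use z b(1) not_vertex[OF z(1)] not_vertex[OF b(1)] in auto)
      then show False using \<open>0 \<le> det3 p3 z b\<close> det3_swap[of p3 z b] by simp
    qed
  qed
  have "0 < det3 p1 b z" if z: "z \<in> I" "z \<noteq> b" for z
  proof (rule ccontr)
    assume "\<not> 0 < det3 p1 b z"
    then have "0 < det3 b p1 z"
      by (rule swap) (use z b(1) not_vertex[OF z(1)] not_vertex[OF b(1)] in auto)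
    note H = pentD[OF pent] pent_intD[OF inside[OF z(1)]] pent_intD[OF inside[OF b(1)]] det3_posD[OF first[OF z]]
      pent_coreD[OF all_in_core[OF z(1)]] pent_coreD[OF all_in_core[OF b(1)]] det3_posD[OF this]
    have "0 < det3 z b p2" by (rule det3_between[of z p2 p3 "- b" "- p1", simplified]) (simp_all add: H)
    note H = H det3_posD[OF this]
    have Q: "pent p1 p2 p3 z b" unfolding pent_def by (simp add: H)
    obtain v where v: "v \<in> I" "pent_int p1 p2 p3 z b v" "pent_core p1 p2 p3 z b v"
      by (rule uniqueE[OF Q]) (use z(1) b(1) in blast)+
    have "v \<noteq> b" using v(2) by (auto simp: pent_int_def)
    then show False
      using det3_posD[OF first[OF v(1)]] pent_coreD[OF v(3)] det3_swap[of b v p3] by simp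
  qed
  then show ?thesis using b(1) first unfolding nearest_def by blast
qed

lemma nearestD:
  assumes "nearest I p q m" "z \<in> I" "z \<noteq> m"
  shows "0 < det3 p m z \<and> 0 < det3 m z p \<and> 0 < det3 z p m \<and> 0 < det3 q z m \<and> 0 < det3 z m q \<and> 0 < det3 m q z"
  using assms det3_posD unfolding nearest_def by blast

text \<open>The nearest points of two diagonals with a common end \<open>q\<close> differ, since one is the first and the
  other the last point met by a line turning about \<open>q\<close>.\<close>
lemma nearest_not_twice:
  assumes "nearest I p q m" "nearest I q r m" "z \<in> I" "z \<noteq> m"
  shows False
  using nearestD[OF assms(1,3,4)] nearestD[OF assms(2,3,4)] det3_swap[of z m q] det3_rotate[of z q m] 
  det3_rotate[of m z q]
  by simp

context critical
begin

text \<open>The first of the three lemmas that treat the possible coincidences among the nearest points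
  \<open>m1, ..., m5\<close> of the five diagonals, here with \<open>m1 = m2\<close> and \<open>m3 = m4\<close>. The pentagon
  \<open>p2 p3 b c a\<close> has a core point \<open>w\<close>, and then \<open>p1 a w b c\<close> is a pentagon whose interior points outside
  the ear of \<open>p1\<close> lie in the first pentagon as well.\<close>
lemma no_triple:
  assumes m: "nearest I p5 p2 a" "nearest I p1 p3 a" "nearest I p2 p4 b" "nearest I p3 p5 b"
      "nearest I p4 p1 c"
    and d: "a \<noteq> b" "a \<noteq> c" "b \<noteq> c"
  shows False
proof -
  have I: "a \<in> I" "b \<in> I" "c \<in> I" using m by (simp_all add: nearest_def)
  note P = pentD[OF pent] pent_intD[OF inside] pent_coreD[OF all_in_core]
  note N = nearestD[OF m(1)] nearestD[OF m(2)] nearestD[OF m(3)] nearestD[OF m(4)] nearestD[OF m(5)]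
  note H = P(1) P(2,3)[OF I(1)] P(2,3)[OF I(2)] P(2,3)[OF I(3)]
    N(1,2)[OF I(2) d(1)[symmetric]] N(1,2)[OF I(3) d(2)[symmetric]]
    N(3,4)[OF I(1) d(1)] N(3,4)[OF I(3) d(3)[symmetric]] N(5)[OF I(1) d(2)] N(5)[OF I(2) d(3)]
  have "0 < det3 a b c" by (rule det3_between[of a b p4 c p1]) (simp_all add: H)
  note H = H det3_posD[OF this]
  have Q: "pent p2 p3 b c a" unfolding pent_def by (simp add: H)
  obtain w where w: "w \<in> I" "pent_int p2 p3 b c a w" "pent_core p2 p3 b c a w"
    and uw: "{v \<in> I. pent_int p2 p3 b c a v} = {w}"
    by (rule uniqueE[OF Q]) (use I in blast)+
  have wd: "w \<noteq> a" "w \<noteq> b" "w \<noteq> c" using w(2) by (auto simp: pent_int_def)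
  note H = H P(2,3)[OF w(1)] N(1,2)[OF w(1) wd(1)] N(3,4)[OF w(1) wd(2)] N(5)[OF w(1) wd(3)]
    pent_intD[OF w(2)] pent_coreD[OF w(3)]
  have "0 < det3 b p1 w" by (rule det3_between[of b p1 a w p2]) (simp_all add: H)
  note H = H det3_posD[OF this]
  have R: "pent p1 a w b c" unfolding pent_def by (simp add: H)
  obtain v where v: "v \<in> I" "pent_int p1 a w b c v" "pent_core p1 a w b c v"
    by (rule uniqueE[OF R]) (use I w(1) in blast)+
  have "pent_int p2 p3 b c a v"
    by (rule pent_int_mono_quad[OF Q R pent_vertices_cl(5)[OF Q] pent_int_imp_cl[OF w(2)]
          pent_vertices_cl(3,4)[OF Q] v(2)])
      (use v(3) in \<open>simp add: pent_core_def\<close>)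
  then have "v = w" using uw v(1) by auto
  then show False using v(2) by (simp add: pent_int_def)
qed

text \<open>Here only \<open>m1 = m2\<close>. The nearest points and \<open>p1\<close> form a pentagon with a core point \<open>z\<close>; the pentagon
  \<open>p2 b c z a\<close> then has an interior point outside the ear of \<open>p2\<close>, hence in the first pentagon, and
  different from \<open>z\<close>.\<close>
lemma no_quadruple:
  assumes m: "nearest I p5 p2 a" "nearest I p1 p3 a" "nearest I p2 p4 b" "nearest I p3 p5 c"
      "nearest I p4 p1 d"
    and d: "a \<noteq> b" "a \<noteq> c" "a \<noteq> d" "b \<noteq> c" "b \<noteq> d" "c \<noteq> d"
  shows False
proof -
  have I: "a \<in> I" "b \<in> I" "c \<in> I" "d \<in> I" using m by (simp_all add: nearest_def)
  note P = pentD[OF pent] pent_intD[OF inside] pent_coreD[OF all_in_core]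
  note N = nearestD[OF m(1)] nearestD[OF m(2)] nearestD[OF m(3)] nearestD[OF m(4)] nearestD[OF m(5)]
  note H = P(1) P(2,3)[OF I(1)] P(2,3)[OF I(2)] P(2,3)[OF I(3)] P(2,3)[OF I(4)]
    N(1,2)[OF I(2) d(1)[symmetric]] N(1,2)[OF I(3) d(2)[symmetric]] N(1,2)[OF I(4) d(3)[symmetric]]
    N(3)[OF I(1) d(1)] N(3)[OF I(3) d(4)[symmetric]] N(3)[OF I(4) d(5)[symmetric]]
    N(4)[OF I(1) d(2)] N(4)[OF I(2) d(4)] N(4)[OF I(4) d(6)[symmetric]]
    N(5)[OF I(1) d(3)] N(5)[OF I(2) d(5)] N(5)[OF I(3) d(6)]
  have "0 < det3 a b d" by (rule det3_between[of a b p4 d p1]) (simp_all add: H)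
  note H = H det3_posD[OF this]
  have "0 < det3 b c p1" by (rule det3_between[of b p1 p2 "- c" p3, simplified]) (simp_all add: H)
  note H = H det3_posD[OF this]
  have "0 < det3 b c a" by (rule det3_between[of b a p2 "- c" p3, simplified]) (simp_all add: H)
  note H = H det3_posD[OF this]
  have "0 < det3 c d a" by (rule det3_between[of c a p3 "- d" "- p1", simplified]) (simp_all add: H)
  note H = H det3_posD[OF this]
  have "0 < det3 c d b" by (rule det3_between[of c b p3 "- d" p4, simplified]) (simp_all add: H)
  note H = H det3_posD[OF this]
  have Q: "pent p1 a b c d" unfolding pent_def by (simp add: H)
  obtain z where z: "z \<in> I" "pent_int p1 a b c d z" "pent_core p1 a b c d z"
    and uz: "{v \<in> I. pent_int p1 a b c d v} = {z}"
    by (rule uniqueE[OF Q]) (use I in blast)+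
  have zd: "z \<noteq> a" "z \<noteq> b" "z \<noteq> c" "z \<noteq> d" using z(2) by (auto simp: pent_int_def)
  note H = H P(2,3)[OF z(1)] N(1,2)[OF z(1) zd(1)] N(3)[OF z(1) zd(2)] N(4)[OF z(1) zd(3)]
    N(5)[OF z(1) zd(4)] pent_intD[OF z(2)] pent_coreD[OF z(3)]
  have "0 < det3 c z p2" by (rule det3_between[of c p2 "- p1" "- z" "- a", simplified]) (simp_all add: H)
  note H = H det3_posD[OF this]
  have R: "pent p2 b c z a" unfolding pent_def by (simp add: H)
  obtain v where v: "v \<in> I" "pent_int p2 b c z a v" "pent_core p2 b c z a v"
    by (rule uniqueE[OF R]) (use I z(1) in blast)+
  have "pent_int p1 a b c d v"
    by (rule pent_int_mono_quad[OF Q R pent_vertices_cl(3,4)[OF Q] pent_int_imp_cl[OF z(2)]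
          pent_vertices_cl(2)[OF Q] v(2)])
      (use v(3) in \<open>simp add: pent_core_def\<close>)
  then have "v = z" using uz v(1) by auto
  then show False using v(2) by (simp add: pent_int_def)
qed

text \<open>The five nearest points form a pentagon with a core point \<open>z\<close>. According to the side of the line
  \<open>z a\<close> on which \<open>p1\<close> lies, \<open>p1 b c z a\<close> or \<open>p1 a z d e\<close> is a pentagon with an interior point
  outside the ear of \<open>p1\<close>, hence a second interior point of the first pentagon.\<close>
lemma no_quintuple:
  assumes m: "nearest I p5 p2 a" "nearest I p1 p3 b" "nearest I p2 p4 c" "nearest I p3 p5 d"
      "nearest I p4 p1 e"
    and d: "a \<noteq> b" "a \<noteq> c" "a \<noteq> d" "a \<noteq> e" "b \<noteq> c" "b \<noteq> d" "b \<noteq> e" "c \<noteq> d" "c \<noteq> e" "d \<noteq> e"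
  shows False
proof -
  have I: "a \<in> I" "b \<in> I" "c \<in> I" "d \<in> I" "e \<in> I" using m by (simp_all add: nearest_def)
  note P = pentD[OF pent] pent_intD[OF inside] pent_coreD[OF all_in_core]
  note N = nearestD[OF m(1)] nearestD[OF m(2)] nearestD[OF m(3)] nearestD[OF m(4)] nearestD[OF m(5)]
  note s = d[symmetric]
  note H = P(1) P(2,3)[OF I(1)] P(2,3)[OF I(2)] P(2,3)[OF I(3)] P(2,3)[OF I(4)] P(2,3)[OF I(5)]
    N(1)[OF I(2) s(1)] N(1)[OF I(3) s(2)] N(1)[OF I(4) s(3)] N(1)[OF I(5) s(4)]
    N(2)[OF I(1) d(1)] N(2)[OF I(3) s(5)] N(2)[OF I(4) s(6)] N(2)[OF I(5) s(7)]
    N(3)[OF I(1) d(2)] N(3)[OF I(2) d(5)] N(3)[OF I(4) s(8)] N(3)[OF I(5) s(9)]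
    N(4)[OF I(1) d(3)] N(4)[OF I(2) d(6)] N(4)[OF I(3) d(8)] N(4)[OF I(5) s(10)]
    N(5)[OF I(1) d(4)] N(5)[OF I(2) d(7)] N(5)[OF I(3) d(9)] N(5)[OF I(4) d(10)]
  have "0 < det3 a b e" by (rule det3_between[of a b "- p1" e "- p2", simplified]) (simp_all add: H)
  note H = H det3_posD[OF this]
  have "0 < det3 a b d" by (rule det3_between[of a b p3 d "- p2", simplified]) (simp_all add: H)
  note H = H det3_posD[OF this]
  have "0 < det3 a c e" by (rule det3_between[of a c p4 e "- p2", simplified]) (simp_all add: H)
  note H = H det3_posD[OF this]
  have "0 < det3 b c a" by (rule det3_between[of b a p1 "- c" p2, simplified]) (simp_all add: H)
  note H = H det3_posD[OF this]
  have "0 < det3 b c e" by (rule det3_between[of b c p4 e p1]) (simp_all add: H)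
  note H = H det3_posD[OF this]
  have "0 < det3 c d b" by (rule det3_between[of c b p2 "- d" p3, simplified]) (simp_all add: H)
  note H = H det3_posD[OF this]
  have "0 < det3 c d a" by (rule det3_between[of c a p2 "- d" "- p5", simplified]) (simp_all add: H)
  note H = H det3_posD[OF this]
  have "0 < det3 d e b" by (rule det3_between[of d b p3 "- e" "- p1", simplified]) (simp_all add: H)
  note H = H det3_posD[OF this]
  have "0 < det3 d e c" by (rule det3_between[of d c p3 "- e" p4, simplified]) (simp_all add: H)
  note H = H det3_posD[OF this]
  have "0 < det3 e a d" by (rule det3_between[of e a "- p5" d "- p1", simplified]) (simp_all add: H)
  note H = H det3_posD[OF this]
  have Q: "pent a b c d e" unfolding pent_def by (simp add: H)
  obtain z where z: "z \<in> I" "pent_int a b c d e z" "pent_core a b c d e z"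
    and uz: "{v \<in> I. pent_int a b c d e v} = {z}"
    by (rule uniqueE[OF Q]) (use I in blast)+
  have zd: "z \<noteq> a" "z \<noteq> b" "z \<noteq> c" "z \<noteq> d" "z \<noteq> e" using z(2) by (auto simp: pent_int_def)
  note H = H P(2,3)[OF z(1)] N(1)[OF z(1) zd(1)] N(2)[OF z(1) zd(2)] N(3)[OF z(1) zd(3)]
    N(4)[OF z(1) zd(4)] N(5)[OF z(1) zd(5)] pent_intD[OF z(2)] pent_coreD[OF z(3)]
  note cls = pent_vertices_cl[OF Q] and clz = pent_int_imp_cl[OF z(2)]
  show False
  proof (cases "0 < det3 z a p1")
    case True
    note H = H det3_posD[OF True]
    have "0 < det3 a p1 c" by (rule det3_between[of a p1 p2 c z]) (simp_all add: H)
    note H = H det3_posD[OF this]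
    have "0 < det3 z p1 c" by (rule det3_between[of z p1 p2 c "- a", simplified]) (simp_all add: H)
    note H = H det3_posD[OF this]
    have R: "pent p1 b c z a" unfolding pent_def by (simp add: H)
    obtain v where v: "v \<in> I" "pent_int p1 b c z a v" "pent_core p1 b c z a v"
      by (rule uniqueE[OF R]) (use I z(1) in blast)+
    have "pent_int a b c d e v"
      by (rule pent_int_mono_quad[OF Q R cls(2,3) clz cls(1) v(2)])
        (use v(3) in \<open>simp add: pent_core_def\<close>)
    then have "v = z" using uz v(1) by auto
    then show False using v(2) by (simp add: pent_int_def)
  next
    case False
    have "0 < det3 a z p1"
      by (rule swap[OF False]) (use zd I z not_vertex[OF I(1)] not_vertex[OF z(1)] in simp_all)
    note H = H det3_posD[OF this]
    have "0 < det3 a d p1" by (rule det3_between[of a p1 "- z" "- d" p2, simplified]) (simp_all add: H)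
    note H = H det3_posD[OF this]
    have "0 < det3 z d p1" by (rule det3_between[of z p1 a "- d" "- p5", simplified]) (simp_all add: H)
    note H = H det3_posD[OF this]
    have R: "pent p1 a z d e" unfolding pent_def by (simp add: H)
    obtain v where v: "v \<in> I" "pent_int p1 a z d e v" "pent_core p1 a z d e v"
      by (rule uniqueE[OF R]) (use I z(1) in blast)+
    have "pent_int a b c d e v"
      by (rule pent_int_mono_quad[OF Q R cls(1) clz cls(4,5) v(2)])
        (use v(3) in \<open>simp add: pent_core_def\<close>)
    then have "v = z" using uz v(1) by auto
    then show False using v(2) by (simp add: pent_int_def)
  qed
qed

lemma no_adjacent:
  assumes m: "nearest I p5 p2 a" "nearest I p1 p3 a" "nearest I p2 p4 b" "nearest I p3 p5 c"
      "nearest I p4 p1 d"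
    and other: "\<And>m. \<exists>z\<in>I. z \<noteq> m"
  shows False
proof -
  interpret r2: critical p2 p3 p4 p5 p1 I by (rule rotate)
  interpret r3: critical p3 p4 p5 p1 p2 I by (rule r2.rotate)
  interpret r4: critical p4 p5 p1 p2 p3 I by (rule r3.rotate)
  have twice: "x \<noteq> y" if "nearest I p q x" "nearest I q r y" for p q r x y
    using nearest_not_twice that other by blast
  have d: "a \<noteq> b" "b \<noteq> d" "d \<noteq> a" "a \<noteq> c"
    using twice[OF m(1,3)] twice[OF m(3,5)] twice[OF m(5,2)] twice[OF m(2,4)] .
  consider "b = c" | "c = d" | "b \<noteq> c" "c \<noteq> d" by blast
  then show False
  proof cases
    case 1
    then show False using no_triple[OF m(1,2,3) _ m(5)] m(4) d by auto
  next
    case 2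
    then show False using r4.no_triple[OF m(4) _ m(1,2,3)] m(5) d by auto
  next
    case 3
    then show False using no_quadruple[OF m] d by auto
  qed
qed

lemma at_most_one: "card I < 2"
proof (rule ccontr)
  assume "\<not> card I < 2"
  then have other: "\<exists>z\<in>I. z \<noteq> m" for m
    using card_mono[of "{m}" I] by fastforce
  then have ne: "I \<noteq> {}" by blast
  interpret r2: critical p2 p3 p4 p5 p1 I by (rule rotate)
  interpret r3: critical p3 p4 p5 p1 p2 I by (rule r2.rotate)
  interpret r4: critical p4 p5 p1 p2 p3 I by (rule r3.rotate)
  interpret r5: critical p5 p1 p2 p3 p4 I by (rule r4.rotate)
  obtain m1 m2 m3 m4 m5 where m: "nearest I p5 p2 m1" "nearest I p1 p3 m2" "nearest I p2 p4 m3"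
      "nearest I p3 p5 m4" "nearest I p4 p1 m5"
    using nearest_exists[OF ne] r2.nearest_exists[OF ne] r3.nearest_exists[OF ne]
      r4.nearest_exists[OF ne] r5.nearest_exists[OF ne] by blast
  have twice: "x \<noteq> y" if "nearest I p q x" "nearest I q r y" for p q r x y
    using nearest_not_twice that other by blast
  have d: "m1 \<noteq> m3" "m3 \<noteq> m5" "m5 \<noteq> m2" "m2 \<noteq> m4" "m4 \<noteq> m1"
    using twice[OF m(1,3)] twice[OF m(3,5)] twice[OF m(5,2)] twice[OF m(2,4)] twice[OF m(4,1)] .
  have "m1 \<noteq> m2" using no_adjacent[OF m(1) _ m(3,4,5) other] m(2) by blast
  moreover have "m2 \<noteq> m3" using r2.no_adjacent[OF m(2) _ m(4,5,1) other] m(3) by blast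
  moreover have "m3 \<noteq> m4" using r3.no_adjacent[OF m(3) _ m(5,1,2) other] m(4) by blast
  moreover have "m4 \<noteq> m5" using r4.no_adjacent[OF m(4) _ m(1,2,3) other] m(5) by blast
  moreover have "m5 \<noteq> m1" using r5.no_adjacent[OF m(5) _ m(2,3,4) other] m(1) by blast
  ultimately show False using no_quintuple[OF m] d by auto
qed

end

lemma empty_pentI:
  "{a, b, c, d, e} \<subseteq> V \<Longrightarrow> pent a b c d e \<Longrightarrow> (\<And>v. v \<in> I \<Longrightarrow> \<not> pent_int a b c d e v) \<Longrightarrow> empty_pent V I"
  unfolding empty_pent_def by blast

lemma empty_pentE:
  assumes "empty_pent V I"
  obtains a b c d e where "{a, b, c, d, e} \<subseteq> V" "pent a b c d e" "\<forall>v\<in>I. \<not> pent_int a b c d e v"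
  using assms unfolding empty_pent_def by blast

lemma general_pos_subset: "general_pos S \<Longrightarrow> T \<subseteq> S \<Longrightarrow> general_pos T"
  unfolding general_pos_def by blast

text \<open>Induction on the number of interior points. A smaller pentagon with at least two interior points
  yields an empty pentagon inside itself, one without interior points is empty, and one with
  a single interior point in an ear yields an empty pentagon too. So a counterexample
  is \<open>critical\<close>.\<close>
theorem two_inside_empty_pent:
  assumes "pent p1 p2 p3 p4 p5" "finite I" "\<And>z. z \<in> I \<Longrightarrow> pent_int p1 p2 p3 p4 p5 z"
    "general_pos ({p1, p2, p3, p4, p5} \<union> I)" "2 \<le> card I"
  shows "empty_pent ({p1, p2, p3, p4, p5} \<union> I) I"
  using assms
proof (induction "card I" arbitrary: p1 p2 p3 p4 p5 I rule: less_induct)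
  case less
  let ?V = "{p1, p2, p3, p4, p5} \<union> I"
  show ?case
  proof (rule ccontr)
    assume none: "\<not> empty_pent ?V I"
    have "critical p1 p2 p3 p4 p5 I"
    proof (rule critical.intro[OF less.prems(1,2,3,4)])
      fix a b c d e
      assume w: "pent a b c d e" "{a, b, c, d, e} \<subseteq> ?V" "{a, b, c, d, e} \<inter> I \<noteq> {}"
      let ?J = "{v \<in> I. pent_int a b c d e v}"
      have ne: "?J \<noteq> {}" using none empty_pentI[OF w(2,1), of I] by auto
      have nv: "v \<notin> ?J" if "v \<in> {a, b, c, d, e}" for v using that by (auto simp: pent_int_def)
      have "?J \<subset> I" using w(3) nv by blast
      then have lt: "card ?J < card I" using less.prems(2) by (simp add: psubset_card_mono)
      have fJ: "finite ?J" using less.prems(2) by simp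
      have "\<not> 2 \<le> card ?J"
      proof
        assume two: "2 \<le> card ?J"
        have "empty_pent ({a, b, c, d, e} \<union> ?J) ?J"
        proof (rule less.hyps[OF lt w(1) fJ _ _ two])
          have "{a, b, c, d, e} \<union> ?J \<subseteq> ?V" using w(2) by blast
          then show "general_pos ({a, b, c, d, e} \<union> ?J)" by (rule general_pos_subset[OF less.prems(4)])
        qed simp
        then obtain a' b' c' d' e' where h: "{a', b', c', d', e'} \<subseteq> {a, b, c, d, e} \<union> ?J"
          "pent a' b' c' d' e'" "\<forall>v\<in>?J. \<not> pent_int a' b' c' d' e' v"
          by (rule empty_pentE)
        have cl: "pent_cl a b c d e x" if "x \<in> {a', b', c', d', e'}" for x
        proof -
          have "x \<in> {a, b, c, d, e} \<or> pent_int a b c d e x" using that h(1) by blast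
          then show ?thesis using pent_vertices_cl[OF w(1)] pent_int_imp_cl by auto
        qed
        have "\<not> pent_int a' b' c' d' e' v" if "v \<in> I" for v
        proof
          assume v: "pent_int a' b' c' d' e' v"
          have "pent_int a b c d e v" by (rule pent_int_mono[OF w(1) h(2) _ _ _ _ _ v]) (simp_all add: cl)
          then show False using h(3) v that by blast
        qed
        moreover have "{a', b', c', d', e'} \<subseteq> ?V" using h(1) w(2) by blast
        ultimately show False using none empty_pentI[OF _ h(2), of ?V I] by simp
      qed
      moreover have "card ?J \<noteq> 0" using ne fJ by simp
      ultimately have "card ?J = 1" by linarith
      then obtain z where z: "?J = {z}" by (rule card_1_singletonE)
      then have zi: "z \<in> I" "pent_int a b c d e z" by blast+
      have ear: "0 < det3 y x z"
        if "pent t x r s y" and eq: "\<And>v. pent_int t x r s y v = pent_int a b c d e v"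
          and "{t, x, r, s, y} = {a, b, c, d, e}"
        for t x r s y
      proof (rule ccontr)
        assume "\<not> 0 < det3 y x z"
        have "x \<noteq> y" using that(1) by (auto simp: pent_def)
        have xy: "x \<in> {a, b, c, d, e}" "y \<in> {a, b, c, d, e}" using that(3) by blast+
        have "x \<noteq> z" "y \<noteq> z" using nv[OF xy(1)] nv[OF xy(2)] z by blast+
        have "0 < det3 x y z"
          by (rule general_pos_swap[OF less.prems(4), of y x z])
            (use subsetD[OF w(2) xy(1)] subsetD[OF w(2) xy(2)] zi(1) \<open>x \<noteq> y\<close> \<open>x \<noteq> z\<close> \<open>y \<noteq> z\<close>
              \<open>\<not> 0 < det3 y x z\<close> in simp_all)
        then have "0 < det3 y z x" using det3_posD by blast
        moreover have "v = z" if "v \<in> I" "pent_int t x r s y v" for v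
          using that(1) that(2)[unfolded eq] z by blast
        ultimately have *: "0 < det3 y v x" if "v \<in> I" "pent_int t x r s y v" for v
          using that by metis
        have wv: "{t, x, r, s, y} \<subseteq> ?V" using w(2) unfolding that(3) .
        have "empty_pent ?V I"
          by (rule empty_pent_of_ear[OF less.prems(2) that(1) wv _ *]) blast+
        then show False using none by contradiction
      qed
      note rots = w(1) pent_rotate[OF w(1)] pent_rotate[OF pent_rotate[OF w(1)]]
        pent_rotate[OF pent_rotate[OF pent_rotate[OF w(1)]]]
        pent_rotate[OF pent_rotate[OF pent_rotate[OF pent_rotate[OF w(1)]]]]
      have r: "pent_int b c d e a v = pent_int a b c d e v" "pent_int c d e a b v = pent_int a b c d e v"
        "pent_int d e a b c v = pent_int a b c d e v" "pent_int e a b c d v = pent_int a b c d e v" for v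
        unfolding pent_int_def by blast+
      have "0 < det3 e b z" by (rule ear[OF rots(1)]) blast+
      moreover have "0 < det3 a c z" by (rule ear[OF rots(2) r(1)]) blast
      moreover have "0 < det3 b d z" by (rule ear[OF rots(3) r(2)]) blast
      moreover have "0 < det3 c e z" by (rule ear[OF rots(4) r(3)]) blast
      moreover have "0 < det3 d a z" by (rule ear[OF rots(5) r(4)]) blast
      ultimately have "pent_core a b c d e z" unfolding pent_core_def by blast
      then show "\<exists>z. ?J = {z} \<and> pent_core a b c d e z" using z by blast
    qed
    then have "card I < 2" by (rule critical.at_most_one)
    then show False using less.prems(5) by simp
  qed
qed

section \<open>Six points around a core point\<close>

text \<open>With a core point added, the five vertices form the configuration of the six diagonals of a regular
  icosahedron: the other five points surround each of the six. In the given chart the pentagon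
  around \<open>p1\<close> passes through the line at infinity, which accounts for the minus signs.\<close>
lemma pent_around:
  assumes "pent p1 p2 p3 p4 p5" "pent_int p1 p2 p3 p4 p5 x" "pent_core p1 p2 p3 p4 p5 x"
  shows "pent p5 (- p3) (- p4) p2 x" "pent_int p5 (- p3) (- p4) p2 x p1"
proof -
  note H = pentD[OF assms(1)] pent_intD[OF assms(2)] pent_coreD[OF assms(3)]
  show "pent p5 (- p3) (- p4) p2 x" unfolding pent_def by (simp add: H)
  show "pent_int p5 (- p3) (- p4) p2 x p1" unfolding pent_int_def by (simp add: H)
qed

text \<open>The hypotheses on \<open>y\<close> say that it lies in the sector at \<open>x\<close> opposite to that of the edge
  \<open>p1 p2\<close>. As long as it has not left the pentagon through \<open>p3 p4\<close> or \<open>p4 p5\<close> it is inside; beyond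
  these edges it is in the pentagon around \<open>p4\<close>.\<close>
lemma beyond_edge_covered:
  assumes p: "pent p1 p2 p3 p4 p5" "pent_int p1 p2 p3 p4 p5 x" "pent_core p1 p2 p3 p4 p5 x"
    and y: "0 < det3 x y p1" "0 < det3 x p2 y" "0 < det3 p1 p2 y"
    and ne: "det3 p3 p4 y \<noteq> 0" "det3 p4 p5 y \<noteq> 0"
  shows "pent_int p1 p2 p3 p4 p5 y \<or> pent_int p3 (- p1) (- p2) p5 x y"
proof -
  note H = pentD[OF p(1)] pent_intD[OF p(2)] pent_coreD[OF p(3)] det3_posD[OF y(1)] det3_posD[OF y(2)] det3_posD[OF y(3)]
  have "0 < det3 p1 p3 y" by (rule det3_between[of p1 p3 x y "- p2", simplified]) (simp_all add: H)
  note H = H det3_posD[OF this]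
  have "0 < det3 p2 y p5" by (rule det3_between[of p2 p5 p1 "- y" "- x", simplified]) (simp_all add: H)
  note H = H det3_posD[OF this]
  consider "0 < det3 p3 p4 y" "0 < det3 p4 p5 y" | "0 < det3 p4 p3 y" | "0 < det3 p5 p4 y"
    using ne det3_swap[of p3 p4 y] det3_swap[of p4 p5 y] by linarith
  then show ?thesis
  proof cases
    case 1
    note H = H det3_posD[OF 1(1)] det3_posD[OF 1(2)]
    have "0 < det3 p3 y p2" by (rule det3_between[of p3 p2 "- p4" "- y" "- p1", simplified]) (simp_all add: H)
    note H = H det3_posD[OF this]
    have "0 < det3 p5 p1 y" by (rule det3_between[of p5 p1 p2 y p4]) (simp_all add: H)
    note H = H det3_posD[OF this]
    show ?thesis unfolding pent_int_def by (simp add: H)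
  next
    case 2
    note H = H det3_posD[OF 2]
    have "0 < det3 x p3 y" by (rule det3_between[of x p3 "- p1" y "- p2", simplified]) (simp_all add: H)
    note H = H det3_posD[OF this]
    have "0 < det3 x y p5" by (rule det3_between[of x p5 p1 "- y" p2, simplified]) (simp_all add: H)
    note H = H det3_posD[OF this]
    show ?thesis unfolding pent_int_def by (simp add: H)
  next
    case 3
    note H = H det3_posD[OF 3]
    have "0 < det3 x p3 y" by (rule det3_between[of x p3 "- p1" y "- p2", simplified]) (simp_all add: H)
    note H = H det3_posD[OF this]
    have "0 < det3 x y p5" by (rule det3_between[of x p5 p1 "- y" p2, simplified]) (simp_all add: H)
    note H = H det3_posD[OF this]
    show ?thesis unfolding pent_int_def by (simp add: H)
  qed
qed

lemma det3_neg_swap: "det3 a b c < 0 \<Longrightarrow> 0 < det3 a c b"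
  by (simp add: det3_def algebra_simps)

text \<open>A core point lies inside the triangle \<open>p1 p3 p4\<close>, so no line through it leaves these three vertices on
  one side.\<close>
lemma not_all_one_side:
  assumes "pent_int p1 p2 p3 p4 p5 x" "pent_core p1 p2 p3 p4 p5 x"
  shows "\<not> (0 < det3 x p1 y \<and> 0 < det3 x p3 y \<and> 0 < det3 x p4 y)"
    "\<not> (det3 x p1 y < 0 \<and> det3 x p3 y < 0 \<and> det3 x p4 y < 0)"
proof -
  have "det3 x p3 p4 * det3 x p1 y + det3 x p4 p1 * det3 x p3 y = (- det3 x p1 p3) * det3 x p4 y"
    by (simp add: det3_def algebra_simps)
  note * = this pent_intD[OF assms(1)] pent_coreD[OF assms(2)]
  have "det3 x p3 p4 * det3 x p1 y + det3 x p4 p1 * det3 x p3 y + det3 x p1 p3 * det3 x p4 y = 0"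
    using * by simp
  moreover have "0 < det3 x p3 p4" "0 < det3 x p4 p1" "0 < det3 x p1 p3" using * by simp_all
  ultimately show "\<not> (0 < det3 x p1 y \<and> 0 < det3 x p3 y \<and> 0 < det3 x p4 y)"
    "\<not> (det3 x p1 y < 0 \<and> det3 x p3 y < 0 \<and> det3 x p4 y < 0)"
    by (smt (verit) mult_pos_pos mult_pos_neg)+
qed

lemma core_triangle_int:
  assumes p: "pent p1 p2 p3 p4 p5" "pent_int p1 p2 p3 p4 p5 x" "pent_core p1 p2 p3 p4 p5 x"
    and z: "0 < det3 x p1 z" "0 < det3 x z p2" "0 < det3 p1 p2 z"
  shows "pent_int p1 p2 p3 p4 p5 z"
proof -
  note H = pentD[OF p(1)] pent_intD[OF p(2)] pent_coreD[OF p(3)] det3_posD[OF z(1)] det3_posD[OF z(2)] det3_posD[OF z(3)]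
  have "0 < det3 p1 z p4" by (rule det3_between[of p1 p4 "- p2" "- z" "- x", simplified]) (simp_all add: H)
  note H = H det3_posD[OF this]
  have "0 < det3 p1 z p5" by (rule det3_between[of p1 p5 "- p2" "- z" "- x", simplified]) (simp_all add: H)
  note H = H det3_posD[OF this]
  have "0 < det3 p2 p3 z" by (rule det3_between[of p2 p3 x z p1]) (simp_all add: H)
  note H = H det3_posD[OF this]
  have "0 < det3 p2 p4 z" by (rule det3_between[of p2 p4 x z p1]) (simp_all add: H)
  note H = H det3_posD[OF this]
  have "0 < det3 x z p3" by (rule det3_between[of x p3 "- p1" "- z" "- p2", simplified]) (simp_all add: H)
  note H = H det3_posD[OF this]
  have "0 < det3 p3 p4 z" by (rule det3_between[of p3 p4 x z p2]) (simp_all add: H)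
  note H = H det3_posD[OF this]
  have "0 < det3 p4 p5 z" by (rule det3_between[of p4 p5 p1 z p2]) (simp_all add: H)
  note H = H det3_posD[OF this]
  show ?thesis unfolding pent_int_def by (simp add: H)
qed

lemma six_cover_sector:
  assumes p: "pent p1 p2 p3 p4 p5" "pent_int p1 p2 p3 p4 p5 x" "pent_core p1 p2 p3 p4 p5 x"
    and s: "det3 x p1 y < 0" "0 < det3 x p2 y"
    and ne: "det3 p1 p2 y \<noteq> 0" "det3 p3 p4 y \<noteq> 0" "det3 p4 p5 y \<noteq> 0"
  shows "\<exists>z\<in>{y, - y}. pent_int p1 p2 p3 p4 p5 z \<or> pent_int p3 (- p1) (- p2) p5 x z"
proof (cases "0 < det3 p1 p2 y")
  case True
  show ?thesis using beyond_edge_covered[OF p det3_neg_swap[OF s(1)] s(2) True ne(2,3)] by blast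
next
  case False
  then have "0 < det3 p1 p2 (- y)" using ne(1) det3_scale[of p1 p2 "-1" y] by simp
  moreover have "0 < det3 x p1 (- y)" using s(1) det3_scale[of x p1 "-1" y] by simp
  moreover have "0 < det3 x (- y) p2" using s(2) by simp
  ultimately have "pent_int p1 p2 p3 p4 p5 (- y)" using core_triangle_int[OF p] by blast
  then show ?thesis by blast
qed

text \<open>The line \<open>x y\<close> separates two consecutive vertices among \<open>p1, ..., p4\<close>. A point outside the given
  pentagon lies in the pentagon around the vertex opposite to this edge.\<close>
lemma six_cover:
  assumes p: "pent p1 p2 p3 p4 p5" "pent_int p1 p2 p3 p4 p5 x" "pent_core p1 p2 p3 p4 p5 x"
    and ne: "\<And>a b. a \<in> {p1, p2, p3, p4, p5, x} \<Longrightarrow> b \<in> {p1, p2, p3, p4, p5, x} \<Longrightarrow> a \<noteq> b \<Longrightarrow> det3 a b y \<noteq> 0"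
  shows "\<exists>z\<in>{y, - y}. pent_int p1 p2 p3 p4 p5 z \<or> pent_int p3 (- p1) (- p2) p5 x z
     \<or> pent_int p4 (- p2) (- p3) p1 x z \<or> pent_int p5 (- p3) (- p4) p2 x z"
proof -
  define far where "far a b c d e z \<longleftrightarrow> pent_int a b c d e z \<or> pent_int c (- a) (- b) e x z" for a b c d e z
  have sector: "\<exists>z\<in>{y, - y}. far a b c d e z"
    if q: "pent a b c d e" "pent_int a b c d e x" "pent_core a b c d e x"
      and V: "{a, b, c, d, e} \<subseteq> {p1, p2, p3, p4, p5}"
      and s: "det3 x a y < 0 \<longleftrightarrow> 0 < det3 x b y" for a b c d e
  proof -
    have d: "distinct [a, b, c, d, e, x]" using q by (auto simp: pent_def pent_int_def)
    have n: "det3 a b y \<noteq> 0" "det3 c d y \<noteq> 0" "det3 d e y \<noteq> 0" "det3 x a y \<noteq> 0" "det3 x b y \<noteq> 0"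
      by (rule ne; use V d in auto)+
    show ?thesis
    proof (cases "det3 x a y < 0")
      case True
      then show ?thesis using six_cover_sector[OF q True _ n(1,2,3)] s unfolding far_def by blast
    next
      case False
      have m: "det3 u v (- y) = - det3 u v y" for u v using det3_scale[of u v "-1" y] by simp
      have "det3 x a (- y) < 0" "0 < det3 x b (- y)"
        using False s n(4,5) unfolding m by linarith+
      then show ?thesis using six_cover_sector[OF q, of "- y"] n(1,2,3) unfolding far_def m by auto
    qed
  qed
  note q2 = pent_rotate[OF p(1)] pent_int_rotate[OF p(2)] pent_core_rotate[OF p(3)]
  note q3 = pent_rotate[OF q2(1)] pent_int_rotate[OF q2(2)] pent_core_rotate[OF q2(3)]
  note q4 = pent_rotate[OF q3(1)] pent_int_rotate[OF q3(2)] pent_core_rotate[OF q3(3)]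
  note q5 = pent_rotate[OF q4(1)] pent_int_rotate[OF q4(2)] pent_core_rotate[OF q4(3)]
  have r: "pent_int p2 p3 p4 p5 p1 z = pent_int p1 p2 p3 p4 p5 z" "pent_int p3 p4 p5 p1 p2 z = pent_int p1 p2 p3 p4 p5 z" for z
    unfolding pent_int_def by blast+
  have "det3 x p1 y \<noteq> 0" "det3 x p2 y \<noteq> 0" "det3 x p3 y \<noteq> 0" "det3 x p4 y \<noteq> 0" "det3 x p5 y \<noteq> 0"
    by (rule ne; use p(2) in \<open>auto simp: pent_int_def\<close>)+
  then consider "det3 x p1 y < 0 \<longleftrightarrow> 0 < det3 x p2 y" | "det3 x p2 y < 0 \<longleftrightarrow> 0 < det3 x p3 y"
    | "det3 x p3 y < 0 \<longleftrightarrow> 0 < det3 x p4 y"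
    using not_all_one_side[OF p(2,3), of y] by argo
  then have "\<exists>z\<in>{y, - y}. far p1 p2 p3 p4 p5 z \<or> far p2 p3 p4 p5 p1 z \<or> far p3 p4 p5 p1 p2 z"
  proof cases
    case 1
    have "\<exists>z\<in>{y, - y}. far p1 p2 p3 p4 p5 z" by (rule sector[OF p _ 1]) blast
    then show ?thesis by blast
  next
    case 2
    have "\<exists>z\<in>{y, - y}. far p2 p3 p4 p5 p1 z" by (rule sector[OF q2 _ 2]) blast
    then show ?thesis by blast
  next
    case 3
    have "\<exists>z\<in>{y, - y}. far p3 p4 p5 p1 p2 z" by (rule sector[OF q3 _ 3]) blast
    then show ?thesis by blast
  qed
  then show ?thesis
    unfolding far_def r by blast
qed

section \<open>Representatives, points and lines\<close>

lemma carrier_line_span: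
  assumes "v \<in> reps p"
  shows "carrier_line p = span {v}"
proof -
  have "subspace (carrier_line p)" "dim (carrier_line p) = 1"
    using carrier_line[of p] by auto
  moreover have "v \<in> carrier_line p" "v \<noteq> 0" using assms by (auto simp: reps_def)
  ultimately show ?thesis
    by (intro subspace_dim_equal[symmetric]) (use span_minimal[of "{v}"] in \<open>auto simp: dim_insert\<close>)
qed

lemma reps_nonempty: "\<exists>v. v \<in> reps p"
proof (rule ccontr)
  assume "\<not> ?thesis"
  then have "carrier_line p \<subseteq> {0}" by (auto simp: reps_def)
  then have "dim (carrier_line p) = 0" by (simp only: dim_eq_0)
  then show False using carrier_line[of p] by (simp del: dim_eq_0)
qed

lemma reps_nonzero: "v \<in> reps p \<Longrightarrow> v \<noteq> 0"
  by (simp add: reps_def)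

lemma reps_iff:
  assumes "v \<in> reps p"
  shows "w \<in> reps p \<longleftrightarrow> (\<exists>c. c \<noteq> 0 \<and> w = c *\<^sub>R v)"
  using carrier_line_span[OF assms] reps_nonzero[OF assms] by (auto simp: reps_def span_singleton)

lemma reps_scale: "v \<in> reps p \<Longrightarrow> c \<noteq> 0 \<Longrightarrow> c *\<^sub>R v \<in> reps p"
  using reps_iff by blast

lemma reps_minus: "v \<in> reps p \<Longrightarrow> - v \<in> reps p"
  using reps_scale[of v p "-1"] by simp

definition point :: "real ^ 3 \<Rightarrow> rp2" where
  "point v = Abs_rp2 (span {v})"

lemma point_rep: "v \<noteq> 0 \<Longrightarrow> v \<in> reps (point v)"
  using Abs_rp2_inverse[of "span {v}"] by (simp add: reps_def point_def dim_insert span_base)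

lemma point_eq: "v \<in> reps p \<Longrightarrow> point v = p"
  using reps_disjoint[OF point_rep] reps_nonzero by blast

lemma proj_line_iff: "proj_line l \<longleftrightarrow> (\<exists>a. a \<noteq> 0 \<and> l = {p. \<exists>v\<in>reps p. a \<bullet> v = 0})"
proof -
  have *: "carrier_line p \<subseteq> {x. a \<bullet> x = 0} \<longleftrightarrow> (\<exists>v\<in>reps p. a \<bullet> v = 0)" for p and a :: "real ^ 3"
  proof
    assume "carrier_line p \<subseteq> {x. a \<bullet> x = 0}"
    then show "\<exists>v\<in>reps p. a \<bullet> v = 0" using reps_nonempty[of p] by (auto simp: reps_def)
  next
    assume "\<exists>v\<in>reps p. a \<bullet> v = 0"
    then obtain v where v: "v \<in> reps p" "a \<bullet> v = 0" by blast
    show "carrier_line p \<subseteq> {x. a \<bullet> x = 0}"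
      using v(2) by (auto simp: carrier_line_span[OF v(1)] span_singleton)
  qed
  show ?thesis
  proof
    assume "proj_line l"
    then obtain W where W: "subspace W" "dim W = 2" "l = {p. carrier_line p \<subseteq> W}"
      unfolding proj_line_def by blast
    obtain a where a: "a \<noteq> 0" "span W \<subseteq> {x. a \<bullet> x = 0}"
      using lowdim_subset_hyperplane[of W] W(2) by auto
    have "W = {x. a \<bullet> x = 0}"
      using a W(1,2) span_superset[of W]
      by (intro subspace_dim_equal) (auto simp: subspace_hyperplane dim_hyperplane)
    then show "\<exists>a. a \<noteq> 0 \<and> l = {p. \<exists>v\<in>reps p. a \<bullet> v = 0}" using a(1) W(3) * by auto
  next
    assume "\<exists>a. a \<noteq> 0 \<and> l = {p. \<exists>v\<in>reps p. a \<bullet> v = 0}"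
    then obtain a :: "real ^ 3" where a: "a \<noteq> 0" "l = {p. \<exists>v\<in>reps p. a \<bullet> v = 0}" by blast
    show "proj_line l"
      unfolding proj_line_def
      by (rule exI[of _ "{x. a \<bullet> x = 0}"]) (use a in \<open>simp add: subspace_hyperplane dim_hyperplane *\<close>)
  qed
qed

lemma parallel_det:
  assumes "v \<in> reps p" "w \<in> reps p"
  shows "det3 v w x = 0" "det3 v x w = 0" "det3 x v w = 0"
proof -
  obtain c where "w = c *\<^sub>R v" using reps_iff[OF assms(1)] assms(2) by blast
  then show "det3 v w x = 0" "det3 v x w = 0" "det3 x v w = 0"
    by (simp_all add: det3_def algebra_simps)
qed

lemma det3_orthogonal:
  assumes "a \<noteq> 0" "a \<bullet> u = 0" "a \<bullet> v = 0" "a \<bullet> w = 0"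
  shows "det3 u v w = 0"
proof -
  have "det3 u v w * (a \<bullet> a) = a \<bullet> (det3 u v w *\<^sub>R a)" by simp
  also have "\<dots> = 0" unfolding cramer[of u v w a] by (simp add: inner_add_right assms)
  finally show ?thesis using assms(1) by simp
qed

lemma det3_inner: "det3 a b v = vector [a$2 * b$3 - a$3 * b$2, a$3 * b$1 - a$1 * b$3, a$1 * b$2 - a$2 * b$1] \<bullet> v"
  by (simp add: det3_def inner_vec_def sum_3 vector_3 algebra_simps)

lemma normal_exists:
  assumes "u \<in> reps p" "v \<in> reps q" "p \<noteq> q"
  obtains a where "a \<noteq> 0" "\<And>w. det3 u v w = a \<bullet> w"
proof
  define a :: "real ^ 3" where "a = vector [u$2 * v$3 - u$3 * v$2, u$3 * v$1 - u$1 * v$3, u$1 * v$2 - u$2 * v$1]"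
  show inner: "\<And>w. det3 u v w = a \<bullet> w" unfolding a_def by (rule det3_inner)
  show "a \<noteq> 0"
  proof
    assume "a = 0"
    then have z: "u$2 * v$3 = u$3 * v$2" "u$3 * v$1 = u$1 * v$3" "u$1 * v$2 = u$2 * v$1"
      unfolding a_def vec_eq_iff by (simp_all add: forall_3 vector_3)
    obtain i where i: "u $ i \<noteq> 0" using reps_nonzero[OF assms(1)] by (auto simp: vec_eq_iff)
    have "v = (v $ i / u $ i) *\<^sub>R u"
      using i z exhaust_3[of i] by (auto simp: vec_eq_iff forall_3 field_simps)
    moreover have "v \<noteq> 0" by (rule reps_nonzero[OF assms(2)])
    ultimately have "v \<in> reps p" using reps_scale[OF assms(1)] by (metis scale_zero_left)
    then show False using reps_disjoint assms(2,3) by blast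
  qed
qed

text \<open>If the determinant vanished, the plane spanned by \<open>u\<close> and \<open>v\<close> would be a line through the three
  points.\<close>
lemma general_position_det:
  assumes P: "general_position P" "p \<in> P" "q \<in> P" "r \<in> P" "distinct [p, q, r]"
    and v: "u \<in> reps p" "v \<in> reps q" "w \<in> reps r"
  shows "det3 u v w \<noteq> 0"
proof
  assume 0: "det3 u v w = 0"
  obtain a where a: "a \<noteq> 0" "\<And>w. det3 u v w = a \<bullet> w"
    using normal_exists[OF v(1,2)] P(5) by auto
  let ?l = "{p. \<exists>v\<in>reps p. a \<bullet> v = 0}"
  have "p \<in> ?l" "q \<in> ?l" "r \<in> ?l"
    using v 0 a(2)[of u] a(2)[of v] a(2)[of w] by auto
  moreover have "proj_line ?l" unfolding proj_line_iff using a(1) by blast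
  ultimately show False using P unfolding general_position_def by blast
qed

lemma general_positionI:
  assumes "\<And>p q r. p \<in> P \<Longrightarrow> q \<in> P \<Longrightarrow> r \<in> P \<Longrightarrow> distinct [p, q, r] \<Longrightarrow>
    \<exists>u\<in>reps p. \<exists>v\<in>reps q. \<exists>w\<in>reps r. det3 u v w \<noteq> 0"
  shows "general_position P"
  unfolding general_position_def
proof (rule notI, elim exE conjE)
  fix l p q r assume l: "proj_line l" "{p, q, r} \<subseteq> P" "distinct [p, q, r]" "{p, q, r} \<subseteq> l"
  obtain a where a: "a \<noteq> 0" "l = {p. \<exists>v\<in>reps p. a \<bullet> v = 0}" using l(1) unfolding proj_line_iff by blast
  have *: "a \<bullet> u = 0" if u: "u \<in> reps x" and x: "x \<in> {p, q, r}" for u x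
  proof -
    obtain v where v: "v \<in> reps x" "a \<bullet> v = 0" using x l(4) a(2) by blast
    then obtain c where "u = c *\<^sub>R v" using reps_iff[OF v(1)] u by blast
    then show ?thesis using v(2) by simp
  qed
  obtain u v w where "u \<in> reps p" "v \<in> reps q" "w \<in> reps r" "det3 u v w \<noteq> 0"
    using assms[of p q r] l(2,3) by auto
  then show False using det3_orthogonal[OF a(1)] * by blast
qed

section \<open>Five points span a pentagon\<close>

lemma weighted_mean_sign:
  fixes x y z :: real
  assumes "p * x + q * z = r * y" "0 < p" "0 < q" "0 < r"
  shows "0 < x \<Longrightarrow> 0 < z \<Longrightarrow> 0 < y" "x < 0 \<Longrightarrow> z < 0 \<Longrightarrow> y < 0"
proof -
  show "0 < y" if "0 < x" "0 < z"
  proof -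
    have "0 < r * y" unfolding assms(1)[symmetric] using that assms by (intro add_pos_pos mult_pos_pos)
    then show ?thesis using assms(4) by (simp add: zero_less_mult_iff)
  qed
  show "y < 0" if "x < 0" "z < 0"
  proof -
    have "r * y < 0" unfolding assms(1)[symmetric] using that assms by (intro add_neg_neg mult_pos_neg)
    then show ?thesis using assms(4) by (simp add: mult_less_0_iff)
  qed
qed

lemma point_minus [simp]: "point (- v) = point v"
  by (cases "v = 0") (auto intro!: point_eq reps_minus point_rep)

text \<open>Seen from \<open>u\<close> the four vectors are sorted, so the signs of \<open>b c d\<close>, \<open>a c d\<close>, \<open>a b d\<close>, \<open>a b c\<close> change at
  most once. Replacing \<open>a, b, c, d\<close> by \<open>b, c, d, - a\<close> keeps the order and permutes the eight
  remaining sign patterns cyclically, so one of its iterates makes all four signs positive.\<close>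
lemma sorted_pent:
  assumes s: "0 < det3 u a b" "0 < det3 u a c" "0 < det3 u a d" "0 < det3 u b c" "0 < det3 u b d"
      "0 < det3 u c d"
    and ne: "det3 a b c \<noteq> 0" "det3 a b d \<noteq> 0" "det3 a c d \<noteq> 0" "det3 b c d \<noteq> 0"
  obtains w x y z where "pent u w x y z"
    "{point w, point x, point y, point z} = {point a, point b, point c, point d}"
proof -
  note H = det3_posD[OF s(1)] det3_posD[OF s(2)] det3_posD[OF s(3)] det3_posD[OF s(4)] det3_posD[OF s(5)] det3_posD[OF s(6)]
  have acd: "det3 u a d * det3 b c d + det3 u c d * det3 a b d = det3 u b d * det3 a c d"
    by (simp add: det3_def algebra_simps)
  have abd: "det3 u a b * det3 a c d + det3 u a d * det3 a b c = det3 u a c * det3 a b d"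
    by (simp add: det3_def algebra_simps)
  have abd': "det3 u a b * det3 b c d + det3 u b d * det3 a b c = det3 u b c * det3 a b d"
    by (simp add: det3_def algebra_simps)
  note mono = weighted_mean_sign[OF acd s(3,6,5)] weighted_mean_sign[OF abd s(1,3,2)]
    weighted_mean_sign[OF abd' s(1,5,4)]
  note * = that
  note neg = det3_neg_swap
  consider "0 < det3 b c d" "0 < det3 a c d" "0 < det3 a b d" "0 < det3 a b c"
    | "0 < det3 b c d" "0 < det3 a c d" "0 < det3 a b d" "det3 a b c < 0"
    | "0 < det3 b c d" "0 < det3 a c d" "det3 a b d < 0" "det3 a b c < 0"
    | "0 < det3 b c d" "det3 a c d < 0" "det3 a b d < 0" "det3 a b c < 0"
    | "det3 b c d < 0" "det3 a c d < 0" "det3 a b d < 0" "det3 a b c < 0"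
    | "det3 b c d < 0" "det3 a c d < 0" "det3 a b d < 0" "0 < det3 a b c"
    | "det3 b c d < 0" "det3 a c d < 0" "0 < det3 a b d" "0 < det3 a b c"
    | "det3 b c d < 0" "0 < det3 a c d" "0 < det3 a b d" "0 < det3 a b c"
    using mono ne by argo
  then show thesis
  proof cases
    case 1
    note H = H det3_posD[OF 1(1)] det3_posD[OF 1(2)] det3_posD[OF 1(3)] det3_posD[OF 1(4)]
    show ?thesis by (rule *[of a b c d]) (auto simp: pent_def H)
  next
    case 2
    note H = H det3_posD[OF 2(1)] det3_posD[OF 2(2)] det3_posD[OF 2(3)] det3_posD[OF neg[OF 2(4)]]
    show ?thesis by (rule *[of d "- a" "- b" "- c"]) (auto simp: pent_def H)
  next
    case 3
    note H = H det3_posD[OF 3(1)] det3_posD[OF 3(2)] det3_posD[OF neg[OF 3(3)]] det3_posD[OF neg[OF 3(4)]]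
    show ?thesis by (rule *[of "- c" "- d" a b]) (auto simp: pent_def H)
  next
    case 4
    note H = H det3_posD[OF 4(1)] det3_posD[OF neg[OF 4(2)]] det3_posD[OF neg[OF 4(3)]] det3_posD[OF neg[OF 4(4)]]
    show ?thesis by (rule *[of b c d "- a"]) (auto simp: pent_def H)
  next
    case 5
    note H = H det3_posD[OF neg[OF 5(1)]] det3_posD[OF neg[OF 5(2)]] det3_posD[OF neg[OF 5(3)]] det3_posD[OF neg[OF 5(4)]]
    show ?thesis by (rule *[of "- a" "- b" "- c" "- d"]) (auto simp: pent_def H)
  next
    case 6
    note H = H det3_posD[OF neg[OF 6(1)]] det3_posD[OF neg[OF 6(2)]] det3_posD[OF neg[OF 6(3)]] det3_posD[OF 6(4)]
    show ?thesis by (rule *[of "- d" a b c]) (auto simp: pent_def H)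
  next
    case 7
    note H = H det3_posD[OF neg[OF 7(1)]] det3_posD[OF neg[OF 7(2)]] det3_posD[OF 7(3)] det3_posD[OF 7(4)]
    show ?thesis by (rule *[of c d "- a" "- b"]) (auto simp: pent_def H)
  next
    case 8
    note H = H det3_posD[OF neg[OF 8(1)]] det3_posD[OF 8(2)] det3_posD[OF 8(3)] det3_posD[OF 8(4)]
    show ?thesis by (rule *[of "- b" "- c" "- d" a]) (auto simp: pent_def H)
  qed
qed

text \<open>The positive orientations with \<open>a\<close> put \<open>b, c, d\<close> into one half-plane, where sorting by angle is
  transitive.\<close>
lemma sort_three:
  assumes a: "0 < det3 u a b" "0 < det3 u a c" "0 < det3 u a d"
    and ne: "det3 u b c \<noteq> 0" "det3 u b d \<noteq> 0" "det3 u c d \<noteq> 0"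
  obtains x y z where "{x, y, z} = {b, c, d}" "0 < det3 u x y" "0 < det3 u x z" "0 < det3 u y z"
    "distinct [b, c, d] \<longrightarrow> distinct [x, y, z]"
proof -
  have gp: "det3 u a b * det3 u c d + det3 u a d * det3 u b c = det3 u a c * det3 u b d"
    by (simp add: det3_def algebra_simps)
  note mono = weighted_mean_sign[OF gp a(1,3,2)]
  have sw: "0 < det3 u y x \<longleftrightarrow> det3 u x y < 0" for x y by (simp add: det3_def algebra_simps)
  consider "0 < det3 u b c" "0 < det3 u b d" "0 < det3 u c d"
    | "0 < det3 u b c" "0 < det3 u b d" "0 < det3 u d c"
    | "0 < det3 u b c" "0 < det3 u d b" "0 < det3 u d c"
    | "0 < det3 u c b" "0 < det3 u b d" "0 < det3 u c d"
    | "0 < det3 u c b" "0 < det3 u d b" "0 < det3 u c d"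
    | "0 < det3 u c b" "0 < det3 u d b" "0 < det3 u d c"
    using mono ne unfolding sw[of d c] sw[of d b] sw[of c b] by argo
  then show thesis
  proof cases
    case 1 then show ?thesis by (intro that[of b c d]) auto
  next
    case 2 then show ?thesis by (intro that[of b d c]) auto
  next
    case 3 then show ?thesis by (intro that[of d b c]) auto
  next
    case 4 then show ?thesis by (intro that[of c b d]) auto
  next
    case 5 then show ?thesis by (intro that[of c d b]) auto
  next
    case 6 then show ?thesis by (intro that[of d c b]) auto
  qed
qed

lemma five_points_pent:
  assumes G: "general_position G" "finite G" "card G = 5"
  obtains a b c d e where "pent a b c d e" "G = {point a, point b, point c, point d, point e}"
proof -
  obtain gs where gs: "set gs = G" "distinct gs" using finite_distinct_list[OF G(2)] by blast
  have "length gs = 5" using gs G(3) distinct_card by metis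
  then obtain g1 g2 g3 g4 g5 where "gs = [g1, g2, g3, g4, g5]"
    by (auto simp: length_Suc_conv numeral_eq_Suc)
  then have g: "G = {g1, g2, g3, g4, g5}" "distinct [g1, g2, g3, g4, g5]" using gs by auto
  have nz: "det3 x y z \<noteq> 0" if "x \<in> reps p" "y \<in> reps q" "z \<in> reps r" "{p, q, r} \<subseteq> G" "distinct [p, q, r]"
    for x y z p q r
    using general_position_det[OF G(1) _ _ _ that(5,1,2,3)] that(4) by simp
  obtain u a where ua: "u \<in> reps g1" "a \<in> reps g2" using reps_nonempty by metis
  have pick: "\<exists>b\<in>reps g. 0 < det3 u a b" if "g \<in> {g3, g4, g5}" for g
  proof -
    obtain b where b: "b \<in> reps g" using reps_nonempty by blast
    have "det3 u a b \<noteq> 0" by (rule nz[OF ua b]) (use that g in auto)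
    then show ?thesis using b reps_minus[OF b] det3_scale[of u a "-1" b]
      by (cases "0 < det3 u a b") (auto intro: bexI[of _ "- b"])
  qed
  obtain b c d where bcd: "b \<in> reps g3" "c \<in> reps g4" "d \<in> reps g5"
    and pos: "0 < det3 u a b" "0 < det3 u a c" "0 < det3 u a d"
    using pick by (metis insertCI)
  have ne: "det3 u b c \<noteq> 0" "det3 u b d \<noteq> 0" "det3 u c d \<noteq> 0"
    using nz[OF ua(1) bcd(1,2)] nz[OF ua(1) bcd(1,3)] nz[OF ua(1) bcd(2,3)] g by auto
  obtain x y z where xyz: "{x, y, z} = {b, c, d}" "0 < det3 u x y" "0 < det3 u x z" "0 < det3 u y z"
    "distinct [b, c, d] \<longrightarrow> distinct [x, y, z]"
    by (rule sort_three[OF pos ne])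
  have pt: "point u = g1" "point a = g2" "point b = g3" "point c = g4" "point d = g5"
    using ua bcd point_eq by auto
  then have "distinct [b, c, d]" using g(2) by auto
  then have xd: "distinct [x, y, z]" using xyz(5) by blast
  have in_bcd: "v \<in> {b, c, d}" if "v \<in> {x, y, z}" for v using that xyz(1) by simp
  have reps: "v \<in> reps (point v) \<and> point v \<in> {g3, g4, g5} \<and> 0 < det3 u a v" if "v \<in> {b, c, d}" for v
    using that bcd pt pos by auto
  have inj: "point v \<noteq> point w" if "v \<in> {b, c, d}" "w \<in> {b, c, d}" "v \<noteq> w" for v w
    using that pt g(2) by auto
  note R = reps[OF in_bcd]
  have pd: "point x \<noteq> point y" "point x \<noteq> point z" "point y \<noteq> point z"
    using inj in_bcd xd by simp_all
  have gd: "g2 \<notin> {g3, g4, g5}" using g(2) by simp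
  have ne2: "det3 a x y \<noteq> 0" "det3 a x z \<noteq> 0" "det3 a y z \<noteq> 0" "det3 x y z \<noteq> 0"
  proof -
    have Rx: "x \<in> reps (point x)" "point x \<in> {g3, g4, g5}" and Ry: "y \<in> reps (point y)" "point y \<in> {g3, g4, g5}"
      and Rz: "z \<in> reps (point z)" "point z \<in> {g3, g4, g5}" using R by simp_all
    have G': "point x \<in> G" "point y \<in> G" "point z \<in> G" "g2 \<in> G" using Rx Ry Rz g(1) by auto
    have n: "g2 \<noteq> point x" "g2 \<noteq> point y" "g2 \<noteq> point z" using Rx Ry Rz gd by auto
    show "det3 a x y \<noteq> 0" by (rule nz[OF ua(2) Rx(1) Ry(1)]) (use G' n pd in simp_all)
    show "det3 a x z \<noteq> 0" by (rule nz[OF ua(2) Rx(1) Rz(1)]) (use G' n pd in simp_all)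
    show "det3 a y z \<noteq> 0" by (rule nz[OF ua(2) Ry(1) Rz(1)]) (use G' n pd in simp_all)
    show "det3 x y z \<noteq> 0" by (rule nz[OF Rx(1) Ry(1) Rz(1)]) (use G' n pd in simp_all)
  qed
  have P: "0 < det3 u a x" "0 < det3 u a y" "0 < det3 u a z" using R by simp_all
  obtain w1 w2 w3 w4 where w: "pent u w1 w2 w3 w4"
    "{point w1, point w2, point w3, point w4} = {point a, point x, point y, point z}"
    by (rule sorted_pent[OF P xyz(2,3,4) ne2])
  have "{point x, point y, point z} = point ` {x, y, z}" by simp
  also have "\<dots> = {g3, g4, g5}" unfolding xyz(1) by (simp add: pt)
  finally have "G = {point u, point w1, point w2, point w3, point w4}"
    unfolding g(1) using w(2) pt by simp
  then show ?thesis using that w(1) by blast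
qed

section \<open>Empty pentagons among seven points\<close>

definition lifts :: "rp2 set \<Rightarrow> (real ^ 3) set" where
  "lifts P = (\<Union>p\<in>P. reps p)"

lemma pent_int_scale:
  assumes "0 < c"
  shows "pent_int a1 a2 a3 a4 a5 (c *\<^sub>R v) \<longleftrightarrow> pent_int a1 a2 a3 a4 a5 v"
  using assms by (simp add: pent_int_def det3_scale zero_less_mult_iff)

text \<open>Every point of \<open>P\<close> inside the pentagon has, up to positive factors, one interior representative. Choosing
  one for each reduces the claim to \<open>two_inside_empty_pent\<close>.\<close>
lemma two_points_inside_empty_pent:
  assumes P: "finite P" "general_position P"
    and u: "pent u1 u2 u3 u4 u5" "{u1, u2, u3, u4, u5} \<subseteq> lifts P"
    and v: "v \<in> reps p" "p \<in> P" "pent_int u1 u2 u3 u4 u5 v" and w: "w \<in> reps q" "q \<in> P" "pent_int u1 u2 u3 u4 u5 w"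
    and pq: "p \<noteq> q"
  shows "empty_pent (lifts P) (lifts P)"
proof -
  let ?U = "{u1, u2, u3, u4, u5}"
  obtain r where r: "\<And>p. r p \<in> reps p" using reps_nonempty by metis
  define I where "I = {z \<in> r ` P \<union> (\<lambda>p. - r p) ` P. pent_int u1 u2 u3 u4 u5 z}"
  have fin: "finite I" using P(1) by (simp add: I_def)
  have I_int: "pent_int u1 u2 u3 u4 u5 z" if "z \<in> I" for z using that by (simp add: I_def)
  have I_lifts: "I \<subseteq> lifts P" using r reps_minus by (auto simp: I_def lifts_def)
  have rep: "\<exists>c>0. c *\<^sub>R z \<in> I" if z: "z \<in> reps s" "s \<in> P" "pent_int u1 u2 u3 u4 u5 z" for z s
  proof -
    obtain c where c: "c \<noteq> 0" "r s = c *\<^sub>R z" using reps_iff[OF z(1)] r by blast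
    show ?thesis
    proof (cases "0 < c")
      case True
      then have "c *\<^sub>R z \<in> I" using z pent_int_scale[OF True] c(2) by (force simp: I_def)
      then show ?thesis using True by blast
    next
      case False
      then have "0 < - c" using c(1) by simp
      then have "pent_int u1 u2 u3 u4 u5 (- c *\<^sub>R z)" using pent_int_scale z(3) by blast
      moreover have eq: "- c *\<^sub>R z = - r s" using c(2) by simp
      ultimately have "- c *\<^sub>R z \<in> I" using z(2) unfolding I_def eq by blast
      then show ?thesis using \<open>0 < - c\<close> by blast
    qed
  qed
  have rps: "x \<in> reps (point x) \<and> point x \<in> P" if "x \<in> ?U \<union> I" for x
    using that u(2) I_lifts point_eq unfolding lifts_def by blast
  have not_neg: "\<not> pent_int u1 u2 u3 u4 u5 (- z)" if "pent_int u1 u2 u3 u4 u5 z" for z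
    using that det3_scale[of u1 u2 "- 1" z] by (simp add: pent_int_def)
  have inj: "point x \<noteq> point y" if x: "x \<in> ?U \<union> I" and y: "y \<in> ?U \<union> I" and xy: "x \<noteq> y" for x y
  proof
    assume eq: "point x = point y"
    have xr: "x \<in> reps (point x)" and yr: "y \<in> reps (point x)" using rps[OF x] rps[OF y] eq by auto
    note z = parallel_det[OF xr yr] parallel_det[OF yr xr]
    consider "x \<in> ?U" "y \<in> ?U" | "x \<in> ?U" "y \<in> I" | "x \<in> I" "y \<in> ?U" | "x \<in> I" "y \<in> I"
      using x y by blast
    then show False
    proof cases
      case 1
      then show False using z xy pentD[OF u(1)] by (elim insertE emptyE) simp_all
    next
      case 2
      then show False using z pent_intD[OF I_int[OF 2(2)]] by (elim insertE emptyE) simp_all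
    next
      case 3
      then show False using z pent_intD[OF I_int[OF 3(1)]] by (elim insertE emptyE) simp_all
    next
      case 4
      have sgn: "z = r (point z) \<or> z = - r (point z)" if zI: "z \<in> I" for z
      proof -
        obtain t where t: "z = r t \<or> z = - r t" using zI by (auto simp: I_def)
        then have "point z = t" using point_eq[OF r[of t]] by (elim disjE) simp_all
        then show ?thesis using t by simp
      qed
      obtain a where "x = a \<or> x = - a" "y = a \<or> y = - a"
        using sgn[OF 4(1)] sgn[OF 4(2)] unfolding eq by metis
      then have "x = y \<or> x = - y" by auto
      then show False using xy not_neg I_int[OF 4(1)] I_int[OF 4(2)] by auto
    qed
  qed
  have gen: "general_pos (?U \<union> I)"
    unfolding general_pos_def
  proof (intro ballI impI)
    fix x y z assume xyz: "x \<in> ?U \<union> I" "y \<in> ?U \<union> I" "z \<in> ?U \<union> I" "distinct [x, y, z]"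
    have "distinct [point x, point y, point z]"
      using inj[OF xyz(1,2)] inj[OF xyz(1,3)] inj[OF xyz(2,3)] xyz(4) by simp
    then show "det3 x y z \<noteq> 0"
      using general_position_det[OF P(2), of "point x" "point y" "point z"] rps xyz(1-3) by blast
  qed
  have card: "2 \<le> card I"
  proof -
    obtain c c' where c: "0 < c" "c *\<^sub>R v \<in> I" "0 < c'" "c' *\<^sub>R w \<in> I" using rep[OF v] rep[OF w] by blast
    have "c *\<^sub>R v \<in> reps p" "c' *\<^sub>R w \<in> reps q" using c v w by (simp_all add: reps_scale)
    then have "c *\<^sub>R v \<noteq> c' *\<^sub>R w" using pq reps_disjoint by metis
    then have "card {c *\<^sub>R v, c' *\<^sub>R w} = 2" by simp
    then show ?thesis using card_mono[OF fin, of "{c *\<^sub>R v, c' *\<^sub>R w}"] c by simp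
  qed
  have "empty_pent (?U \<union> I) I" by (rule two_inside_empty_pent[OF u(1) fin I_int gen card])
  then obtain a b c d e where h: "{a, b, c, d, e} \<subseteq> ?U \<union> I" "pent a b c d e" "\<forall>v\<in>I. \<not> pent_int a b c d e v"
    by (rule empty_pentE)
  have cl: "pent_cl u1 u2 u3 u4 u5 x" if "x \<in> ?U \<union> I" for x
    using that pent_vertices_cl[OF u(1)] pent_int_imp_cl[OF I_int] by auto
  show ?thesis
  proof (rule empty_pentI[OF _ h(2)])
    show "{a, b, c, d, e} \<subseteq> lifts P" using h(1) u(2) I_lifts by blast
    fix z assume "z \<in> lifts P"
    then obtain s where s: "s \<in> P" "z \<in> reps s" unfolding lifts_def by blast
    show "\<not> pent_int a b c d e z"
    proof
      assume i: "pent_int a b c d e z"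
      have "pent_int u1 u2 u3 u4 u5 z"
        by (rule pent_int_mono[OF u(1) h(2) _ _ _ _ _ i]) (use h(1) in \<open>simp_all add: cl\<close>)
      then obtain c where "0 < c" "c *\<^sub>R z \<in> I" using rep[OF s(2,1)] by blast
      then show False using h(3) i pent_int_scale by blast
    qed
  qed
qed

lemma pent_reps:
  assumes "pent a b c d e" "x \<in> {a, b, c, d, e}"
  shows "x \<in> reps (point x)"
proof -
  have "x \<noteq> 0" using assms by (auto simp: pent_def det3_def)
  then show ?thesis by (rule point_rep)
qed

lemma pent_points_distinct:
  assumes "pent a b c d e"
  shows "distinct [point a, point b, point c, point d, point e]"
proof -
  have *: "point x \<noteq> point y" if "x \<in> {a, b, c, d, e}" "y \<in> {a, b, c, d, e}" "0 < det3 x y z" for x y z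
  proof
    assume "point x = point y"
    then have "y \<in> reps (point x)" using pent_reps[OF assms that(2)] by simp
    then have "det3 x y z = 0" by (rule parallel_det(1)[OF pent_reps[OF assms that(1)]])
    then show False using that(3) by simp
  qed
  have "point e \<noteq> point a" by (rule *[of e a b]) (simp_all add: pentD[OF assms])
  then show ?thesis using *[of a b c] *[of a c d] *[of a d e] *[of b c d] *[of b d e] *[of b e a]
    *[of c d e] *[of c e a] *[of d e a] pentD[OF assms] by (simp add: not_sym)
qed

lemma general_position_subset: "general_position P \<Longrightarrow> Q \<subseteq> P \<Longrightarrow> general_position Q"
  unfolding general_position_def by (meson order_trans)

lemma lifts_reps: "v \<in> lifts P \<Longrightarrow> v \<in> reps (point v) \<and> point v \<in> P"
  by (auto simp: lifts_def point_eq)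

lemma lifts_minus: "v \<in> lifts P \<Longrightarrow> - v \<in> lifts P"
  by (auto simp: lifts_def intro: reps_minus)

text \<open>If no pentagon is empty, then each contains exactly one point \<open>x\<close>, and \<open>x\<close> is in its core,
  since otherwise a vertex could be moved to \<open>x\<close> to empty the pentagon.
  A seventh point \<open>y\<close> then lies in a pentagon around one of the vertices, and this pentagon has two interior points.\<close>
theorem seven_points_empty_pent:
  assumes P: "finite P" "general_position P" "7 \<le> card P"
  shows "empty_pent (lifts P) (lifts P)"
proof (rule ccontr)
  assume none: "\<not> empty_pent (lifts P) (lifts P)"
  obtain G where G: "G \<subseteq> P" "card G = 5" "finite G"
    using obtain_subset_with_card_n[of 5 P] P(3) by auto
  obtain u1 u2 u3 u4 u5 where u: "pent u1 u2 u3 u4 u5" and Gu: "G = {point u1, point u2, point u3, point u4, point u5}"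
    using five_points_pent[OF general_position_subset[OF P(2) G(1)] G(3,2)] by blast
  let ?U = "{u1, u2, u3, u4, u5}"
  have U: "x \<in> reps (point x)" "point x \<in> G" if "x \<in> ?U" for x
    using pent_reps[OF u that] that Gu by auto
  have U_lifts: "?U \<subseteq> lifts P" using U G(1) unfolding lifts_def by blast
  have unique: "p = q"
    if "pent a b c d e" "{a, b, c, d, e} \<subseteq> lifts P" "v \<in> reps p" "p \<in> P" "pent_int a b c d e v"
      "w \<in> reps q" "q \<in> P" "pent_int a b c d e w" for a b c d e v w p q
    using two_points_inside_empty_pent[OF P(1,2) that] none by blast
  obtain x where x: "x \<in> lifts P" "pent_int u1 u2 u3 u4 u5 x"
    using empty_pentI[OF U_lifts u] none by blast
  define p where "p = point x"
  have xp: "x \<in> reps p" "p \<in> P" using lifts_reps[OF x(1)] by (auto simp: p_def)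
  have pG: "point v \<noteq> p" if "v \<in> ?U" for v
  proof
    assume "point v = p"
    then have "v \<in> reps p" using U(1)[OF that] by simp
    note z = parallel_det[OF this xp(1)] parallel_det[OF xp(1) this]
    show False using z pent_intD[OF x(2)] that by (elim insertE emptyE) simp_all
  qed
  have dU: "point v \<noteq> point w" if "v \<in> ?U" "w \<in> ?U" "v \<noteq> w" for v w
    using pent_points_distinct[OF u] that by (elim insertE emptyE) auto
  have ear: "0 < det3 e b x"
    if w: "pent a b c d e" "\<And>v. pent_int a b c d e v = pent_int u1 u2 u3 u4 u5 v" "{a, b, c, d, e} = ?U" for a b c d e
  proof (rule ccontr)
    assume neg: "\<not> 0 < det3 e b x"
    have V: "b \<in> ?U" "e \<in> ?U" unfolding w(3)[symmetric] by simp_all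
    have "e \<noteq> b" using w(1) by (auto simp: pent_def)
    then have "det3 e b x \<noteq> 0"
      using general_position_det[OF P(2) _ _ xp(2) _ U(1)[OF V(2)] U(1)[OF V(1)] xp(1)]
        pG[OF V(1)] pG[OF V(2)] dU[OF V(2,1)] U(2)[OF V(1)] U(2)[OF V(2)] G(1) by auto
    then have "0 < det3 e x b" using neg by (intro det3_neg_swap) simp
    moreover have ix: "pent_int a b c d e x" using w(2) x(2) by simp
    ultimately have q: "pent x b c d e" using pent_replace_ear[OF w(1)] by blast
    have sub: "pent_int a b c d e v" if "pent_int x b c d e v" for v
      by (rule pent_int_mono[OF w(1) q _ _ _ _ _ that])
        (use pent_vertices_cl[OF w(1)] pent_int_imp_cl[OF ix] in auto)
    have "{x, b, c, d, e} \<subseteq> lifts P" using U_lifts x(1) w(3) by blast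
    then obtain v where v: "v \<in> lifts P" "pent_int x b c d e v" using empty_pentI[OF _ q] none by blast
    then have "pent_int u1 u2 u3 u4 u5 v" using sub w(2) by blast
    then have "p = point v" using unique[OF u U_lifts xp x(2)] lifts_reps[OF v(1)] by blast
    then have "det3 x b v = 0" using parallel_det(2)[OF xp(1)] lifts_reps[OF v(1)] by simp
    then show False using v(2) by (simp add: pent_int_def)
  qed
  note u2 = pent_rotate[OF u] note u3 = pent_rotate[OF u2] note u4 = pent_rotate[OF u3]
  note u5 = pent_rotate[OF u4]
  note x2 = pent_int_rotate[OF x(2)] note x3 = pent_int_rotate[OF x2] note x4 = pent_int_rotate[OF x3]
  note x5 = pent_int_rotate[OF x4]
  have r: "pent_int u2 u3 u4 u5 u1 v = pent_int u1 u2 u3 u4 u5 v" "pent_int u3 u4 u5 u1 u2 v = pent_int u1 u2 u3 u4 u5 v"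
    "pent_int u4 u5 u1 u2 u3 v = pent_int u1 u2 u3 u4 u5 v" "pent_int u5 u1 u2 u3 u4 v = pent_int u1 u2 u3 u4 u5 v" for v
    unfolding pent_int_def by blast+
  have "0 < det3 u5 u2 x" by (rule ear[OF u]) blast+
  moreover have "0 < det3 u1 u3 x" by (rule ear[OF u2 r(1)]) blast
  moreover have "0 < det3 u2 u4 x" by (rule ear[OF u3 r(2)]) blast
  moreover have "0 < det3 u3 u5 x" by (rule ear[OF u4 r(3)]) blast
  moreover have "0 < det3 u4 u1 x" by (rule ear[OF u5 r(4)]) blast
  ultimately have c: "pent_core u1 u2 u3 u4 u5 x" unfolding pent_core_def by blast
  note c2 = pent_core_rotate[OF c] note c3 = pent_core_rotate[OF c2] note c4 = pent_core_rotate[OF c3]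
  note c5 = pent_core_rotate[OF c4]
  have "card (insert p G) < card P" using card_insert_le_m1[of 6 G p] G(2) P(3) by (simp add: card_insert_if G(3))
  then obtain q where q: "q \<in> P" "q \<notin> insert p G"
    using card_mono[of "insert p G" P] G(3) by (metis finite_insert not_less subsetI)
  obtain y where y: "y \<in> reps q" using reps_nonempty by blast
  have ne: "det3 a b y \<noteq> 0" if ab: "a \<in> {u1, u2, u3, u4, u5, x}" "b \<in> {u1, u2, u3, u4, u5, x}" "a \<noteq> b" for a b
  proof -
    have V: "v \<in> reps (point v) \<and> point v \<in> insert p G" if "v \<in> insert x ?U" for v
      using that U xp p_def by auto
    have ab': "a \<in> insert x ?U" "b \<in> insert x ?U" using ab(1,2) by auto
    have "point a \<noteq> point b"
      using ab' ab(3) pG dU p_def by (metis insertE)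
    moreover have "point a \<noteq> q" "point b \<noteq> q" using V[OF ab'(1)] V[OF ab'(2)] q(2) by auto
    moreover have "point a \<in> P" "point b \<in> P" using V[OF ab'(1)] V[OF ab'(2)] xp(2) G(1) by auto
    ultimately show ?thesis
      using general_position_det[OF P(2) _ _ q(1) _ _ _ y] V[OF ab'(1)] V[OF ab'(2)] by auto
  qed
  have "\<exists>z\<in>{y, - y}. pent_int u1 u2 u3 u4 u5 z \<or> pent_int u3 (- u1) (- u2) u5 x z
     \<or> pent_int u4 (- u2) (- u3) u1 x z \<or> pent_int u5 (- u3) (- u4) u2 x z"
    by (rule six_cover[OF u x(2) c ne])
  then obtain z where z: "z \<in> {y, - y}" "pent_int u1 u2 u3 u4 u5 z \<or> pent_int u3 (- u1) (- u2) u5 x z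
     \<or> pent_int u4 (- u2) (- u3) u1 x z \<or> pent_int u5 (- u3) (- u4) u2 x z" by blast
  have zq: "z \<in> reps q" using z(1) y reps_minus by auto
  have L: "v \<in> lifts P" "- v \<in> lifts P" if "v \<in> insert x ?U" for v
    using that U_lifts x(1) lifts_minus by auto
  have qU: "q \<noteq> point v" "v \<in> reps (point v)" "point v \<in> P" if "v \<in> ?U" for v
    using U[OF that] q(2) G(1) by auto
  from z(2) show False
  proof (elim disjE)
    assume "pent_int u1 u2 u3 u4 u5 z"
    then have "p = q" using unique[OF u U_lifts xp x(2) zq q(1)] by blast
    then show False using q(2) by blast
  next
    assume i: "pent_int u3 (- u1) (- u2) u5 x z"
    note a = pent_around[OF u4 x4 c4]
    have "q = point u4" by (rule unique[OF a(1) _ zq q(1) i qU(2,3) a(2)]) (simp_all add: L)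
    then show False using qU(1)[of u4] by simp
  next
    assume i: "pent_int u4 (- u2) (- u3) u1 x z"
    note a = pent_around[OF u5 x5 c5]
    have "q = point u5" by (rule unique[OF a(1) _ zq q(1) i qU(2,3) a(2)]) (simp_all add: L)
    then show False using qU(1)[of u5] by simp
  next
    assume i: "pent_int u5 (- u3) (- u4) u2 x z"
    note a = pent_around[OF u x(2) c]
    have "q = point u1" by (rule unique[OF a(1) _ zq q(1) i qU(2,3) a(2)]) (simp_all add: L)
    then show False using qU(1)[of u1] by simp
  qed
qed

section \<open>Polygons in the projective plane\<close>

text \<open>The polygon is defined by its five sides rather than as a hull, which makes its interior visible.\<close>
definition gon :: "real ^ 3 \<Rightarrow> real ^ 3 \<Rightarrow> real ^ 3 \<Rightarrow> real ^ 3 \<Rightarrow> real ^ 3 \<Rightarrow> rp2 set" where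
  "gon a b c d e = {p. \<exists>v\<in>reps p. pent_cl a b c d e v}"

text \<open>The union of the lines is the union of the images of \<open>U - {0}\<close> under all nonzero homotheties.\<close>
lemma open_lines_meeting:
  assumes "open U"
  shows "open {p. \<exists>v\<in>reps p. v \<in> U}"
proof -
  have eq: "(\<Union>p\<in>{p. \<exists>v\<in>reps p. v \<in> U}. reps p) = (\<Union>c\<in>- {0}. (*\<^sub>R) c ` (U - {0}))"
  proof (intro equalityI subsetI)
    fix w assume "w \<in> (\<Union>p\<in>{p. \<exists>v\<in>reps p. v \<in> U}. reps p)"
    then obtain p v where v: "w \<in> reps p" "v \<in> reps p" "v \<in> U" by auto
    then obtain c where c: "c \<noteq> 0" "w = c *\<^sub>R v" using reps_iff[OF v(2)] by auto
    have "v \<in> U - {0}" using v(3) reps_nonzero[OF v(2)] by simp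
    then have "w \<in> (*\<^sub>R) c ` (U - {0})" unfolding c(2) by (rule imageI)
    then show "w \<in> (\<Union>c\<in>- {0}. (*\<^sub>R) c ` (U - {0}))" using c(1) by auto
  next
    fix w assume "w \<in> (\<Union>c\<in>- {0}. (*\<^sub>R) c ` (U - {0}))"
    then obtain c v where v: "c \<noteq> 0" "v \<in> U" "v \<noteq> 0" "w = c *\<^sub>R v" by auto
    have "v \<in> reps (point v)" by (rule point_rep[OF v(3)])
    moreover from this have "w \<in> reps (point v)" unfolding v(4) using v(1) by (rule reps_scale)
    ultimately show "w \<in> (\<Union>p\<in>{p. \<exists>v\<in>reps p. v \<in> U}. reps p)" using v(2) by auto
  qed
  have "open (U - {0})" using assms by (intro open_Diff) auto
  then have "open (\<Union>c\<in>- {0::real}. (*\<^sub>R) c ` (U - {0}))"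
    by (intro open_UN ballI open_scaling) auto
  then show ?thesis unfolding open_rp2_def eq .
qed

text \<open>Of the two segments between \<open>p\<close> and \<open>q\<close>, the one that stays off the line orthogonal to \<open>n\<close> consists of the
  combinations of representatives on the same side of that line. A semiconvex set in this
  Euclidean plane must contain it.\<close>
lemma semiconvex_cone:
  assumes X: "semiconvex X" "\<And>p v. p \<in> X \<Longrightarrow> v \<in> reps p \<Longrightarrow> n \<bullet> v \<noteq> 0"
    and u: "u \<in> reps p" "p \<in> X" "0 < n \<bullet> u" and v: "v \<in> reps q" "q \<in> X" "0 < n \<bullet> v"
    and st: "0 \<le> s" "0 \<le> t" "w \<in> reps r" "w = s *\<^sub>R u + t *\<^sub>R v"
  shows "r \<in> X"
proof -
  obtain S where S: "proj_segment p q S" "S \<subseteq> X" using X(1) u(2) v(2) unfolding semiconvex_def by blast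
  then obtain u' v' where uv': "u' \<in> reps p" "v' \<in> reps q"
    "S = {x. \<exists>s\<ge>0. \<exists>t\<ge>0. s *\<^sub>R u' + t *\<^sub>R v' \<in> reps x}"
    unfolding proj_segment_def by blast
  have inX: "x \<in> X" if "s *\<^sub>R u' + t *\<^sub>R v' \<in> reps x" "0 \<le> s" "0 \<le> t" for x s t
    using that S(2) uv'(3) by blast
  obtain \<alpha> where \<alpha>: "\<alpha> \<noteq> 0" "u = \<alpha> *\<^sub>R u'" using reps_iff[OF uv'(1)] u(1) by blast
  obtain \<beta> where \<beta>: "\<beta> \<noteq> 0" "v = \<beta> *\<^sub>R v'" using reps_iff[OF uv'(2)] v(1) by blast
  have nu: "0 < \<alpha> * (n \<bullet> u')" "0 < \<beta> * (n \<bullet> v')" using u(3) v(3) \<alpha>(2) \<beta>(2) by simp_all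
  have w: "w = (s * \<alpha>) *\<^sub>R u' + (t * \<beta>) *\<^sub>R v'" using st(4) \<alpha>(2) \<beta>(2) by simp
  show ?thesis
  proof (cases "0 < \<alpha> * \<beta>")
    case True
    then consider "0 < \<alpha>" "0 < \<beta>" | "\<alpha> < 0" "\<beta> < 0" by (auto simp: zero_less_mult_iff)
    then show ?thesis
    proof cases
      case 1
      have "(s * \<alpha>) *\<^sub>R u' + (t * \<beta>) *\<^sub>R v' \<in> reps r" unfolding w[symmetric] by (rule st(3))
      then show ?thesis by (rule inX) (use st(1,2) 1 in simp_all)
    next
      case 2
      have "- w = (s * (- \<alpha>)) *\<^sub>R u' + (t * (- \<beta>)) *\<^sub>R v'" unfolding w by simp
      then have "(s * (- \<alpha>)) *\<^sub>R u' + (t * (- \<beta>)) *\<^sub>R v' \<in> reps r"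
        using reps_minus[OF st(3)] by simp
      then show ?thesis by (rule inX) (use st(1,2) 2 in \<open>simp_all add: mult_nonneg_nonpos\<close>)
    qed
  next
    case False
    \<comment> \<open>The chosen segment crosses the line orthogonal to \<open>n\<close>, which \<open>X\<close> avoids. The crossing
      point is that of \<open>z\<close>, unless \<open>z = 0\<close>, and then \<open>p\<close> and \<open>q\<close> coincide.\<close>
    define z where "z = \<bar>n \<bullet> v'\<bar> *\<^sub>R u' + \<bar>n \<bullet> u'\<bar> *\<^sub>R v'"
    have "(0 < n \<bullet> u' \<and> n \<bullet> v' < 0) \<or> (n \<bullet> u' < 0 \<and> 0 < n \<bullet> v')"
      using False nu by (auto simp: zero_less_mult_iff)
    then have nz: "n \<bullet> z = 0" and pos: "0 < \<bar>n \<bullet> v'\<bar>"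
      by (auto simp: z_def inner_add_right)
    have "z = 0"
    proof (rule ccontr)
      assume "z \<noteq> 0"
      then have "z \<in> reps (point z)" by (rule point_rep)
      moreover have "point z \<in> X"
        by (rule inX[of "\<bar>n \<bullet> v'\<bar>" "\<bar>n \<bullet> u'\<bar>"]) (use \<open>z \<in> reps (point z)\<close> in \<open>simp_all add: z_def\<close>)
      ultimately show False using X(2) nz by blast
    qed
    then have "u' = (- (\<bar>n \<bullet> u'\<bar> / \<bar>n \<bullet> v'\<bar>)) *\<^sub>R v'"
      using pos by (simp add: z_def field_simps eq_neg_iff_add_eq_0 vec_eq_iff)
    moreover have "u' \<noteq> 0" using reps_nonzero uv'(1) by blast
    ultimately have "u' \<in> reps q" using reps_iff[OF uv'(2)] by (metis scale_zero_left)
    then have "p = q" using reps_disjoint uv'(1) by blast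
    then obtain k where k: "v = k *\<^sub>R u" using reps_iff[OF u(1)] v(1) by blast
    have "w = (s + t * k) *\<^sub>R u" using st(4) k by (simp add: scaleR_add_left)
    moreover have "w \<noteq> 0" using reps_nonzero st(3) by blast
    ultimately have "w \<in> reps p" using reps_iff[OF u(1)] by (metis scale_zero_left)
    then show ?thesis using reps_disjoint st(3) u(2) by blast
  qed
qed

lemma proj_convex_cone:
  assumes n: "\<And>v. v \<in> C \<Longrightarrow> v \<noteq> 0 \<Longrightarrow> 0 < n \<bullet> v" "n \<noteq> 0"
    and C: "\<And>u v s t. u \<in> C \<Longrightarrow> v \<in> C \<Longrightarrow> 0 \<le> s \<Longrightarrow> 0 \<le> t \<Longrightarrow> s *\<^sub>R u + t *\<^sub>R v \<in> C"
  shows "proj_convex {p. \<exists>v\<in>reps p. v \<in> C}"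
  unfolding proj_convex_def
proof
  show "semiconvex {p. \<exists>v\<in>reps p. v \<in> C}"
    unfolding semiconvex_def
  proof (intro ballI)
    fix p q assume "p \<in> {p. \<exists>v\<in>reps p. v \<in> C}" "q \<in> {p. \<exists>v\<in>reps p. v \<in> C}"
    then obtain u v where u: "u \<in> reps p" "u \<in> C" and v: "v \<in> reps q" "v \<in> C" by blast
    let ?S = "{x. \<exists>s\<ge>0. \<exists>t\<ge>0. s *\<^sub>R u + t *\<^sub>R v \<in> reps x}"
    have "proj_segment p q ?S" unfolding proj_segment_def using u(1) v(1) by blast
    moreover have "?S \<subseteq> {p. \<exists>v\<in>reps p. v \<in> C}" using C[OF u(2) v(2)] by blast
    ultimately show "\<exists>S. proj_segment p q S \<and> S \<subseteq> {p. \<exists>v\<in>reps p. v \<in> C}" by blast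
  qed
  let ?l = "{p. \<exists>v\<in>reps p. n \<bullet> v = 0}"
  have "{p. \<exists>v\<in>reps p. v \<in> C} \<subseteq> - ?l"
  proof
    fix p assume "p \<in> {p. \<exists>v\<in>reps p. v \<in> C}"
    then obtain u where u: "u \<in> reps p" "u \<in> C" by blast
    then have "0 < n \<bullet> u" using n(1) reps_nonzero by blast
    then have "n \<bullet> v \<noteq> 0" if "v \<in> reps p" for v
      using reps_iff[OF u(1)] that by force
    then show "p \<in> - ?l" by blast
  qed
  moreover have "euclidean_plane (- ?l)"
    unfolding euclidean_plane_def proj_line_iff using n(2) by blast
  ultimately show "\<exists>\<rho>. euclidean_plane \<rho> \<and> {p. \<exists>v\<in>reps p. v \<in> C} \<subseteq> \<rho>" by blast
qed

lemma pent_cl_comb: "pent_cl a b c d e u \<Longrightarrow> pent_cl a b c d e v \<Longrightarrow> 0 \<le> s \<Longrightarrow> 0 \<le> t \<Longrightarrow> pent_cl a b c d e (s *\<^sub>R u + t *\<^sub>R v)"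
  by (simp add: pent_cl_def det3_linear)

definition cone5 :: "real ^ 3 \<Rightarrow> real ^ 3 \<Rightarrow> real ^ 3 \<Rightarrow> real ^ 3 \<Rightarrow> real ^ 3 \<Rightarrow> (real ^ 3) set" where
  "cone5 a b c d e = {v. \<exists>x\<ge>0. \<exists>y\<ge>0. \<exists>z\<ge>0. \<exists>t\<ge>0. \<exists>u\<ge>0.
     v = x *\<^sub>R a + y *\<^sub>R b + z *\<^sub>R c + t *\<^sub>R d + u *\<^sub>R e}"

lemma cone5I:
  "0 \<le> x \<Longrightarrow> 0 \<le> y \<Longrightarrow> 0 \<le> z \<Longrightarrow> 0 \<le> t \<Longrightarrow> 0 \<le> u \<Longrightarrow>
    x *\<^sub>R a + y *\<^sub>R b + z *\<^sub>R c + t *\<^sub>R d + u *\<^sub>R e \<in> cone5 a b c d e"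
  unfolding cone5_def by blast

lemma cone5E:
  assumes "v \<in> cone5 a b c d e"
  obtains x y z t u where "0 \<le> x" "0 \<le> y" "0 \<le> z" "0 \<le> t" "0 \<le> u"
    "v = x *\<^sub>R a + y *\<^sub>R b + z *\<^sub>R c + t *\<^sub>R d + u *\<^sub>R e"
  using assms unfolding cone5_def by auto

lemma cone5_comb:
  assumes "v \<in> cone5 a b c d e" "w \<in> cone5 a b c d e" "0 \<le> s" "0 \<le> r"
  shows "s *\<^sub>R v + r *\<^sub>R w \<in> cone5 a b c d e"
proof -
  obtain x y z t u where v: "0 \<le> x" "0 \<le> y" "0 \<le> z" "0 \<le> t" "0 \<le> u"
    "v = x *\<^sub>R a + y *\<^sub>R b + z *\<^sub>R c + t *\<^sub>R d + u *\<^sub>R e" by (rule cone5E[OF assms(1)])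
  obtain x' y' z' t' u' where w: "0 \<le> x'" "0 \<le> y'" "0 \<le> z'" "0 \<le> t'" "0 \<le> u'"
    "w = x' *\<^sub>R a + y' *\<^sub>R b + z' *\<^sub>R c + t' *\<^sub>R d + u' *\<^sub>R e" by (rule cone5E[OF assms(2)])
  have "s *\<^sub>R v + r *\<^sub>R w = (s * x + r * x') *\<^sub>R a + (s * y + r * y') *\<^sub>R b + (s * z + r * z') *\<^sub>R c
      + (s * t + r * t') *\<^sub>R d + (s * u + r * u') *\<^sub>R e"
    unfolding v(6) w(6) by (simp add: algebra_simps)
  also have "\<dots> \<in> cone5 a b c d e"
    by (rule cone5I) (use v(1-5) w(1-5) assms(3,4) in simp_all)
  finally show ?thesis .
qed

lemma cone5_vertex: "w \<in> {a, b, c, d, e} \<Longrightarrow> w \<in> cone5 a b c d e"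
  using cone5I[of 1 0 0 0 0 a b c d e] cone5I[of 0 1 0 0 0 a b c d e] cone5I[of 0 0 1 0 0 a b c d e]
    cone5I[of 0 0 0 1 0 a b c d e] cone5I[of 0 0 0 0 1 a b c d e]
  by auto

lemma cone5_eq_pent_cl:
  assumes "pent a b c d e"
  shows "cone5 a b c d e = {v. pent_cl a b c d e v}"
proof (intro equalityI subsetI)
  fix v assume "v \<in> cone5 a b c d e"
  then obtain x y z t u where v: "0 \<le> x" "0 \<le> y" "0 \<le> z" "0 \<le> t" "0 \<le> u"
    "v = x *\<^sub>R a + y *\<^sub>R b + z *\<^sub>R c + t *\<^sub>R d + u *\<^sub>R e" by (rule cone5E)
  note V = pent_vertices_cl[OF assms]
  have "pent_cl a b c d e (1 *\<^sub>R (1 *\<^sub>R (1 *\<^sub>R (x *\<^sub>R a + y *\<^sub>R b) + z *\<^sub>R c) + t *\<^sub>R d) + u *\<^sub>R e)"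
    by (intro pent_cl_comb V) (use v(1-5) in simp_all)
  then show "v \<in> {v. pent_cl a b c d e v}" using v(6) by simp
next
  fix v assume "v \<in> {v. pent_cl a b c d e v}"
  then have v: "pent_cl a b c d e v" by simp
  show "v \<in> cone5 a b c d e"
    by (rule pent_comb[OF assms v]) (simp add: cone5I)
qed

lemma cone5_pos:
  assumes w: "\<And>w. w \<in> {a, b, c, d, e} \<Longrightarrow> 0 < n \<bullet> w" and v: "v \<in> cone5 a b c d e" "v \<noteq> 0"
  shows "0 < n \<bullet> v"
proof -
  obtain x y z t u where x: "0 \<le> x" "0 \<le> y" "0 \<le> z" "0 \<le> t" "0 \<le> u"
    and veq: "v = x *\<^sub>R a + y *\<^sub>R b + z *\<^sub>R c + t *\<^sub>R d + u *\<^sub>R e" by (rule cone5E[OF v(1)])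
  have "n \<bullet> v = x * (n \<bullet> a) + y * (n \<bullet> b) + z * (n \<bullet> c) + t * (n \<bullet> d) + u * (n \<bullet> e)"
    unfolding veq by (simp add: inner_add_right)
  moreover have "0 \<le> x * (n \<bullet> a)" "0 \<le> y * (n \<bullet> b)" "0 \<le> z * (n \<bullet> c)" "0 \<le> t * (n \<bullet> d)" "0 \<le> u * (n \<bullet> e)"
    using x w by (simp_all add: less_imp_le)
  moreover have "\<not> (x = 0 \<and> y = 0 \<and> z = 0 \<and> t = 0 \<and> u = 0)" using v(2) veq by auto
  moreover have "0 < x * (n \<bullet> a) \<or> x = 0" "0 < y * (n \<bullet> b) \<or> y = 0" "0 < z * (n \<bullet> c) \<or> z = 0"
    "0 < t * (n \<bullet> d) \<or> t = 0" "0 < u * (n \<bullet> e) \<or> u = 0"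
    using x w by (simp_all add: zero_less_mult_iff less_le)
  ultimately show ?thesis by argo
qed

text \<open>The vectors on the positive side of \<open>n\<close> that represent points of \<open>X\<close> form, with the zero vector,
  a convex cone. The zero vector needs separate treatment, as it represents no point.\<close>
lemma cone_subset_convex:
  assumes X: "semiconvex X" "\<And>p v. p \<in> X \<Longrightarrow> v \<in> reps p \<Longrightarrow> n \<bullet> v \<noteq> 0"
    and w: "\<And>w. w \<in> {a, b, c, d, e} \<Longrightarrow> point w \<in> X \<and> 0 < n \<bullet> w"
    and v: "v \<in> cone5 a b c d e" "v \<noteq> 0"
  shows "point v \<in> X"
proof -
  obtain x y z t u where x: "0 \<le> x" "0 \<le> y" "0 \<le> z" "0 \<le> t" "0 \<le> u"
    "v = x *\<^sub>R a + y *\<^sub>R b + z *\<^sub>R c + t *\<^sub>R d + u *\<^sub>R e" by (rule cone5E[OF v(1)])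
  define K where "K v \<longleftrightarrow> v = 0 \<or> (0 < n \<bullet> v \<and> point v \<in> X)" for v
  have K0: "K w" if "w \<in> {a, b, c, d, e}" for w using w[OF that] by (simp add: K_def)
  have K: "K (s *\<^sub>R v + r *\<^sub>R w)" if Kvw: "K v" "K w" "0 \<le> s" "0 \<le> r" for v w s r
  proof -
    have ex: "\<exists>v'. K v' \<and> v' \<noteq> 0 \<and> (\<exists>s'\<ge>0. s *\<^sub>R v = s' *\<^sub>R v')" if "K v" "0 \<le> s" for v s
    proof (cases "v = 0")
      case True
      have "K a" "a \<noteq> 0" using K0[of a] w[of a] by auto
      then show ?thesis using True by (intro exI[of _ a]) (auto intro: exI[of _ 0])
    next
      case False
      then show ?thesis using that by blast
    qed
    obtain v' s' w' r' where vw: "K v'" "v' \<noteq> 0" "0 \<le> s'" "s *\<^sub>R v = s' *\<^sub>R v'"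
      "K w'" "w' \<noteq> 0" "0 \<le> r'" "r *\<^sub>R w = r' *\<^sub>R w'"
      using ex[OF Kvw(1,3)] ex[OF Kvw(2,4)] by blast
    let ?z = "s' *\<^sub>R v' + r' *\<^sub>R w'"
    have n: "0 < n \<bullet> v'" "point v' \<in> X" "0 < n \<bullet> w'" "point w' \<in> X" using vw unfolding K_def by auto
    have "K ?z"
    proof (cases "?z = 0")
      case True
      then show ?thesis by (simp add: K_def)
    next
      case False
      then have "s' \<noteq> 0 \<or> r' \<noteq> 0" by auto
      moreover have "0 \<le> s' * (n \<bullet> v')" "0 \<le> r' * (n \<bullet> w')"
        "s' \<noteq> 0 \<longrightarrow> 0 < s' * (n \<bullet> v')" "r' \<noteq> 0 \<longrightarrow> 0 < r' * (n \<bullet> w')"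
        using n vw(3,7) by simp_all
      ultimately have "0 < n \<bullet> ?z" unfolding inner_add_right inner_scaleR_right by argo
      moreover have "point ?z \<in> X"
        by (rule semiconvex_cone[OF X point_rep[OF vw(2)] n(2,1) point_rep[OF vw(6)] n(4,3) vw(3,7)
              point_rep[OF False] refl])
      ultimately show ?thesis by (simp add: K_def)
    qed
    then show ?thesis using vw by simp
  qed
  have "K (1 *\<^sub>R (1 *\<^sub>R (1 *\<^sub>R (x *\<^sub>R a + y *\<^sub>R b) + z *\<^sub>R c) + t *\<^sub>R d) + u *\<^sub>R e)"
    by (intro K K0) (use x in simp_all)
  then show ?thesis using x(6) v(2) by (simp add: K_def)
qed

text \<open>The sum of the five side functionals is positive on the pentagon. Its kernel serves as the line at
  infinity.\<close>
lemma chart_exists: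
  assumes "pent a b c d e"
  obtains n where "n \<noteq> 0" "\<And>w. w \<in> {a, b, c, d, e} \<Longrightarrow> 0 < n \<bullet> w"
    "\<And>v. pent_cl a b c d e v \<Longrightarrow> v \<noteq> 0 \<Longrightarrow> 0 < n \<bullet> v"
proof -
  let ?h = "\<lambda>v. det3 a b v + det3 b c v + det3 c d v + det3 d e v + det3 e a v"
  obtain n where n: "\<And>v. n \<bullet> v = ?h v"
  proof -
    obtain n1 n2 n3 n4 n5 where "\<And>v. det3 a b v = n1 \<bullet> v" "\<And>v. det3 b c v = n2 \<bullet> v"
      "\<And>v. det3 c d v = n3 \<bullet> v" "\<And>v. det3 d e v = n4 \<bullet> v" "\<And>v. det3 e a v = n5 \<bullet> v"
      using det3_inner by metis
    then show ?thesis using that[of "n1 + n2 + n3 + n4 + n5"] by (simp add: inner_add_left)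
  qed
  have pos: "0 < n \<bullet> w" if "w \<in> {a, b, c, d, e}" for w
    using that pentD[OF assms] unfolding n by auto
  have cl: "0 < n \<bullet> v" if "pent_cl a b c d e v" "v \<noteq> 0" for v
    by (rule cone5_pos[OF pos]) (use that cone5_eq_pent_cl[OF assms] in auto)
  have "n \<noteq> 0" using pos[of a] by auto
  then show ?thesis using that pos cl by blast
qed

text \<open>A smaller convex set containing the vertices lies in the same Euclidean plane, so it contains the
  cone that they span there.\<close>
lemma gon_hull:
  assumes w: "pent a b c d e"
  shows "proj_convex_hull {point a, point b, point c, point d, point e} (gon a b c d e)"
proof -
  let ?G = "{point a, point b, point c, point d, point e}"
  obtain n where n: "n \<noteq> 0" "\<And>w. w \<in> {a, b, c, d, e} \<Longrightarrow> 0 < n \<bullet> w"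
    "\<And>v. pent_cl a b c d e v \<Longrightarrow> v \<noteq> 0 \<Longrightarrow> 0 < n \<bullet> v" by (rule chart_exists[OF w]) blast
  have "proj_convex {p. \<exists>v\<in>reps p. v \<in> {v. pent_cl a b c d e v}}"
    by (rule proj_convex_cone[of _ n]) (use n(1,3) pent_cl_comb in auto)
  then have conv: "proj_convex (gon a b c d e)" by (simp add: gon_def)
  have mem: "point x \<in> gon a b c d e" if "x \<in> {a, b, c, d, e}" for x
    using pent_reps[OF w that] that pent_vertices_cl[OF w] unfolding gon_def by auto
  have "gon a b c d e \<subseteq> X" if X: "proj_convex X" "?G \<subseteq> X" "X \<subseteq> gon a b c d e" for X
  proof
    fix p assume "p \<in> gon a b c d e"
    then obtain v where v: "v \<in> reps p" "pent_cl a b c d e v" unfolding gon_def by blast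
    then have vc: "v \<in> cone5 a b c d e" using cone5_eq_pent_cl[OF w] by simp
    have ne: "n \<bullet> u \<noteq> 0" if q: "q \<in> X" "u \<in> reps q" for q u
    proof -
      obtain v where v: "v \<in> reps q" "pent_cl a b c d e v" using q(1) X(3) unfolding gon_def by blast
      then have "0 < n \<bullet> v" using n(3) reps_nonzero by blast
      then show ?thesis using reps_iff[OF v(1)] q(2) by force
    qed
    have "point v \<in> X"
      by (rule cone_subset_convex[OF _ ne _ vc reps_nonzero[OF v(1)]])
        (use X(1,2) n(2) in \<open>auto simp: proj_convex_def\<close>)
    then show "p \<in> X" using point_eq[OF v(1)] by simp
  qed
  then show ?thesis unfolding proj_convex_hull_def using conv mem by auto
qed

lemma open_pent_int: "open {v. pent_int a b c d e v}"
  unfolding pent_int_def det3_inner by (intro open_Collect_conj open_Collect_less continuous_intros)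

text \<open>At a point where a side functional vanishes, a small step across this side leaves the polygon. The
  step must also stay on the positive side of a chart, because the polygon contains the negatives
  of its representatives.\<close>
lemma interior_gon:
  assumes w: "pent a b c d e"
  shows "interior (gon a b c d e) = {p. \<exists>v\<in>reps p. pent_int a b c d e v}"
proof
  have "open {p. \<exists>v\<in>reps p. v \<in> {v. pent_int a b c d e v}}"
    by (rule open_lines_meeting[OF open_pent_int])
  then have op: "open {p. \<exists>v\<in>reps p. pent_int a b c d e v}" by simp
  have "{p. \<exists>v\<in>reps p. pent_int a b c d e v} \<subseteq> gon a b c d e"
    unfolding gon_def using pent_int_imp_cl by blast
  then show "{p. \<exists>v\<in>reps p. pent_int a b c d e v} \<subseteq> interior (gon a b c d e)"
    by (rule interior_maximal[OF _ op])
  show "interior (gon a b c d e) \<subseteq> {p. \<exists>v\<in>reps p. pent_int a b c d e v}"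
  proof
    fix p assume "p \<in> interior (gon a b c d e)"
    then obtain T where T: "open T" "p \<in> T" "T \<subseteq> gon a b c d e" unfolding interior_def by blast
    obtain v where v: "v \<in> reps p" "pent_cl a b c d e v" using T unfolding gon_def by blast
    obtain n where n: "\<And>v. pent_cl a b c d e v \<Longrightarrow> v \<noteq> 0 \<Longrightarrow> 0 < n \<bullet> v" by (rule chart_exists[OF w]) blast
    let ?O = "\<Union>p\<in>T. reps p"
    have O: "open ?O" "v \<in> ?O" using T(1,2) v(1) unfolding open_rp2_def by auto
    have strict: "0 < det3 x y v" if xy: "0 \<le> det3 x y v" "\<And>u. pent_cl a b c d e u \<Longrightarrow> 0 \<le> det3 x y u" "0 < det3 x y z"
      for x y z
    proof (rule ccontr)
      assume "\<not> 0 < det3 x y v"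
      then have 0: "det3 x y v = 0" using xy(1) by simp
      have lim: "((\<lambda>r. v - r *\<^sub>R z) \<longlongrightarrow> v - 0 *\<^sub>R z) (at_right 0)"
        by (intro tendsto_intros)
      have "\<forall>\<^sub>F r in at_right 0. v - r *\<^sub>R z \<in> ?O"
        using topological_tendstoD[OF lim O(1)] O(2) by simp
      moreover have "((\<lambda>r. n \<bullet> (v - r *\<^sub>R z)) \<longlongrightarrow> n \<bullet> (v - 0 *\<^sub>R z)) (at_right 0)"
        by (intro tendsto_intros lim)
      then have "\<forall>\<^sub>F r in at_right 0. 0 < n \<bullet> (v - r *\<^sub>R z)"
        using n[OF v(2) reps_nonzero[OF v(1)]] by (intro order_tendstoD(1)) auto
      moreover have "\<forall>\<^sub>F r in at_right (0::real). 0 < r" by (rule eventually_at_right_less)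
      ultimately have "\<forall>\<^sub>F r in at_right (0::real). v - r *\<^sub>R z \<in> ?O \<and> 0 < n \<bullet> (v - r *\<^sub>R z) \<and> 0 < r"
        by eventually_elim simp
      then have "\<exists>r. v - r *\<^sub>R z \<in> ?O \<and> 0 < n \<bullet> (v - r *\<^sub>R z) \<and> 0 < r"
        by (rule eventually_happens'[OF trivial_limit_at_right_real])
      then obtain r where r: "v - r *\<^sub>R z \<in> ?O" "0 < n \<bullet> (v - r *\<^sub>R z)" "0 < r"
        by (elim exE conjE)
      then obtain q where q: "v - r *\<^sub>R z \<in> reps q" "q \<in> gon a b c d e" using T(3) by blast
      then obtain u where u: "u \<in> reps q" "pent_cl a b c d e u" unfolding gon_def by blast
      then obtain k where k: "v - r *\<^sub>R z = k *\<^sub>R u" using reps_iff[OF u(1)] q(1) by blast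
      have "0 < n \<bullet> u" using n u reps_nonzero by blast
      then have "0 < k" using r(2) unfolding k by (simp add: zero_less_mult_iff)
      then have "0 \<le> det3 x y (k *\<^sub>R u)" using xy(2)[OF u(2)] by (simp add: det3_scale)
      moreover have "det3 x y (v - r *\<^sub>R z) < 0" using 0 r(3) xy(3) by (simp add: det3_linear)
      ultimately show False unfolding k by simp
    qed
    note H = pentD[OF w]
    have "pent_int a b c d e v"
      unfolding pent_int_def
      using strict[of a b c] strict[of b c d] strict[of c d e] strict[of d e a] strict[of e a b] v(2) H
      unfolding pent_cl_def by blast
    then show "p \<in> {p. \<exists>v\<in>reps p. pent_int a b c d e v}" using v(1) by blast
  qed
qed

lemma gon_frontier:
  assumes w: "pent a b c d e"
  shows "{point a, point b, point c, point d, point e} \<subseteq> frontier (gon a b c d e)"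
proof -
  have "point x \<in> frontier (gon a b c d e)" if x: "x \<in> {a, b, c, d, e}" for x
  proof -
    have xr: "x \<in> reps (point x)" by (rule pent_reps[OF w x])
    have "pent_cl a b c d e x" using x pent_vertices_cl[OF w] by auto
    then have "point x \<in> gon a b c d e" using xr unfolding gon_def by blast
    moreover have "\<not> pent_int a b c d e v" if "v \<in> reps (point x)" for v
      using x parallel_det[OF xr that] by (elim insertE emptyE) (simp_all add: pent_int_def)
    then have "point x \<notin> interior (gon a b c d e)" unfolding interior_gon[OF w] by blast
    ultimately show ?thesis unfolding frontier_def using closure_subset by blast
  qed
  then show ?thesis by simp
qed

section \<open>Uniqueness of the polygon of five points\<close>

text \<open>The open cone spanned by \<open>y1, y2, y3\<close> is a neighbourhood of \<open>x\<close> inside the cone.\<close>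
lemma inside_cone_not_frontier:
  assumes y: "y1 \<in> cone5 a b c d e" "y2 \<in> cone5 a b c d e" "y3 \<in> cone5 a b c d e" "0 < det3 y1 y2 y3"
    and x: "k *\<^sub>R x = r *\<^sub>R y1 + s *\<^sub>R y2 + t *\<^sub>R y3" "0 < k" "0 < r" "0 < s" "0 < t" "x \<noteq> 0"
  shows "point x \<notin> frontier {p. \<exists>v\<in>reps p. v \<in> cone5 a b c d e}"
proof -
  let ?H = "{p. \<exists>v\<in>reps p. v \<in> cone5 a b c d e}"
  let ?U = "{v. 0 < det3 y2 y3 v \<and> 0 < det3 y3 y1 v \<and> 0 < det3 y1 y2 v}"
  have "open ?U"
    unfolding det3_inner by (intro open_Collect_conj open_Collect_less continuous_intros)
  then have op: "open {p. \<exists>v\<in>reps p. v \<in> ?U}" by (rule open_lines_meeting)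
  have "?U \<subseteq> cone5 a b c d e"
  proof
    fix v assume "v \<in> ?U"
    then have "0 \<le> det3 y2 y3 v" "0 \<le> det3 y3 y1 v" "0 \<le> det3 y1 y2 v" by (simp_all add: less_imp_le)
    then obtain x y z where v: "0 \<le> x" "0 \<le> y" "0 \<le> z" "v = x *\<^sub>R y1 + y *\<^sub>R y2 + z *\<^sub>R y3"
      by (rule triangle_comb[OF y(4)])
    have "1 *\<^sub>R (x *\<^sub>R y1 + y *\<^sub>R y2) + z *\<^sub>R y3 \<in> cone5 a b c d e"
      by (intro cone5_comb y(1-3) v(1-3)) simp
    then show "v \<in> cone5 a b c d e" using v(4) by simp
  qed
  then have "{p. \<exists>v\<in>reps p. v \<in> ?U} \<subseteq> ?H" by blast
  then have "{p. \<exists>v\<in>reps p. v \<in> ?U} \<subseteq> interior ?H" by (rule interior_maximal[OF _ op])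
  moreover have "x \<in> ?U"
  proof -
    note P = det3_posD[OF y(4)]
    have "k * det3 y2 y3 x = r * det3 y2 y3 y1" "k * det3 y3 y1 x = s * det3 y3 y1 y2"
      "k * det3 y1 y2 x = t * det3 y1 y2 y3"
      unfolding det3_scale[symmetric] x(1) by (simp_all add: det3_linear)
    then have "0 < k * det3 y2 y3 x" "0 < k * det3 y3 y1 x" "0 < k * det3 y1 y2 x"
      using P x(3-5) by simp_all
    then show ?thesis using x(2) by (simp add: zero_less_mult_iff)
  qed
  ultimately have "point x \<in> interior ?H" using point_rep[OF x(6)] by blast
  then show ?thesis by (simp add: frontier_def)
qed

text \<open>The linear relation of four vertices in their cyclic order has signs \<open>+ - + -\<close>. After an odd number of sign
  changes it expresses one of the four vectors as a positive combination of the other three, and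
  its point would be interior to the hull.\<close>
lemma four_signs:
  fixes i j k l :: real
  assumes pos: "0 < det3 p q r" "0 < det3 p q s" "0 < det3 p r s" "0 < det3 q r s"
    and sg: "i \<in> {1, -1}" "j \<in> {1, -1}" "k \<in> {1, -1}" "l \<in> {1, -1}"
    and C: "i *\<^sub>R p \<in> cone5 a b c d e" "j *\<^sub>R q \<in> cone5 a b c d e" "k *\<^sub>R r \<in> cone5 a b c d e"
      "l *\<^sub>R s \<in> cone5 a b c d e"
    and fr: "\<And>w. w \<in> {p, q, r, s} \<Longrightarrow> point w \<in> frontier {p. \<exists>v\<in>reps p. v \<in> cone5 a b c d e}"
  shows "i * j * k * l = 1"
proof (rule ccontr)
  assume odd: "i * j * k * l \<noteq> 1"
  have rel: "det3 q r s *\<^sub>R p + det3 p q s *\<^sub>R r = det3 p r s *\<^sub>R q + det3 p q r *\<^sub>R s"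
    by (simp add: vec_eq_iff forall_3 det3_def algebra_simps)
  have nz: "w \<noteq> 0" if "w \<in> {p, q, r, s}" for w using that pos by (auto simp: det3_def)
  have no: False if "y1 \<in> cone5 a b c d e" "y2 \<in> cone5 a b c d e" "y3 \<in> cone5 a b c d e"
      "0 < det3 y1 y2 y3 \<or> 0 < det3 y2 y1 y3" "x \<in> {p, q, r, s} \<or> - x \<in> {p, q, r, s}"
      "m *\<^sub>R x = f *\<^sub>R y1 + g *\<^sub>R y2 + h *\<^sub>R y3" "0 < m" "0 < f" "0 < g" "0 < h"
    for x y1 y2 y3 m f g h
  proof -
    have x: "x \<noteq> 0" using nz that(5) by fastforce
    have px: "point x \<in> frontier {p. \<exists>v\<in>reps p. v \<in> cone5 a b c d e}"
      using fr[of x] fr[of "- x"] that(5) by auto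
    show False
    proof (cases "0 < det3 y1 y2 y3")
      case True
      show ?thesis using inside_cone_not_frontier[OF that(1-3) True that(6-10) x] px by contradiction
    next
      case False
      then have "0 < det3 y2 y1 y3" using that(4) by simp
      moreover have "m *\<^sub>R x = g *\<^sub>R y2 + f *\<^sub>R y1 + h *\<^sub>R y3" using that(6) by (simp add: add.commute)
      ultimately show ?thesis
        using inside_cone_not_frontier[OF that(2,1,3) _ _ that(7,9,8,10) x] px by blast
    qed
  qed
  note H = det3_posD[OF pos(1)] det3_posD[OF pos(2)] det3_posD[OF pos(3)] det3_posD[OF pos(4)]
  \<comment> \<open>The vector whose sign stands alone in the relation \<open>rel\<close> becomes interior.\<close>
  consider "i = -1" "j = 1" "k = 1" "l = 1" | "i = 1" "j = -1" "k = 1" "l = 1"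
    | "i = 1" "j = 1" "k = -1" "l = 1" | "i = 1" "j = 1" "k = 1" "l = -1"
    | "i = 1" "j = -1" "k = -1" "l = -1" | "i = -1" "j = 1" "k = -1" "l = -1"
    | "i = -1" "j = -1" "k = 1" "l = -1" | "i = -1" "j = -1" "k = -1" "l = 1"
    using sg odd by auto
  then show False
  proof cases
    case 1
    then show False
      using no[OF C(1,2,4), of r "det3 p q s" "det3 q r s" "det3 p r s" "det3 p q r"] rel H
      by (simp add: algebra_simps)
  next
    case 2
    then show False
      using no[OF C(1,3,2), of s "det3 p q r" "det3 q r s" "det3 p q s" "det3 p r s"] rel H
      by (simp add: algebra_simps)
  next
    case 3
    then show False
      using no[OF C(2,4,3), of p "det3 q r s" "det3 p r s" "det3 p q r" "det3 p q s"] rel H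
      by (simp add: algebra_simps)
  next
    case 4
    then show False
      using no[OF C(1,3,4), of q "det3 p r s" "det3 q r s" "det3 p q s" "det3 p q r"] rel H
      by (simp add: algebra_simps)
  next
    case 5
    then show False
      using no[OF C(1,2,4), of "- r" "det3 p q s" "det3 q r s" "det3 p r s" "det3 p q r"] rel H
      by (simp add: algebra_simps)
  next
    case 6
    then show False
      using no[OF C(1,3,2), of "- s" "det3 p q r" "det3 q r s" "det3 p q s" "det3 p r s"] rel H
      by (simp add: algebra_simps)
  next
    case 7
    then show False
      using no[OF C(2,4,3), of "- p" "det3 q r s" "det3 p r s" "det3 p q r" "det3 p q s"] rel H
      by (simp add: algebra_simps)
  next
    case 8
    then show False
      using no[OF C(1,3,4), of "- q" "det3 p r s" "det3 q r s" "det3 p q s" "det3 p q r"] rel H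
      by (simp add: algebra_simps)
  qed
qed

text \<open>The line avoided by \<open>H\<close> selects a sign for each vertex. The cone of the signed vertices gives a convex
  set between the vertices and \<open>H\<close>, so minimality forces equality.\<close>
lemma hull_eq_cone:
  assumes H: "proj_convex_hull {point a, point b, point c, point d, point e} H"
    and nz: "0 \<notin> {a, b, c, d, e}"
  obtains i j k l m where "{i, j, k, l, m} \<subseteq> {1, -1 :: real}"
    "H = {p. \<exists>v\<in>reps p. v \<in> cone5 (i *\<^sub>R a) (j *\<^sub>R b) (k *\<^sub>R c) (l *\<^sub>R d) (m *\<^sub>R e)}"
proof -
  let ?G = "{point a, point b, point c, point d, point e}"
  have conv: "semiconvex H" "?G \<subseteq> H" using H unfolding proj_convex_hull_def proj_convex_def by auto
  have minimal: "X = H" if "proj_convex X" "?G \<subseteq> X" "X \<subseteq> H" for X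
    using H that unfolding proj_convex_hull_def by blast
  obtain L where "proj_line L" "H \<subseteq> - L"
    using H unfolding proj_convex_hull_def proj_convex_def euclidean_plane_def by auto
  then obtain n where n: "n \<noteq> 0" "H \<subseteq> - {p. \<exists>v\<in>reps p. n \<bullet> v = 0}" unfolding proj_line_iff by auto
  have ne: "n \<bullet> v \<noteq> 0" if "p \<in> H" "v \<in> reps p" for p v using n(2) that by blast
  define s where "s v = (if 0 < n \<bullet> v then 1 else - 1 :: real)" for v
  have s: "0 < n \<bullet> (s v *\<^sub>R v)" "point (s v *\<^sub>R v) = point v" "s v *\<^sub>R v \<in> reps (point v)"
    if "v \<in> {a, b, c, d, e}" for v
  proof -
    have "v \<noteq> 0" using nz that by blast
    then have v: "v \<in> reps (point v)" by (rule point_rep)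
    have "point v \<in> H" using conv(2) that by blast
    then have "n \<bullet> v \<noteq> 0" using ne v by blast
    then show "0 < n \<bullet> (s v *\<^sub>R v)" by (simp add: s_def)
    show "point (s v *\<^sub>R v) = point v" by (simp add: s_def)
    show "s v *\<^sub>R v \<in> reps (point v)" using v reps_minus by (simp add: s_def)
  qed
  let ?a = "s a *\<^sub>R a" and ?b = "s b *\<^sub>R b" and ?c = "s c *\<^sub>R c" and ?d = "s d *\<^sub>R d" and ?e = "s e *\<^sub>R e"
  let ?X = "{p. \<exists>v\<in>reps p. v \<in> cone5 ?a ?b ?c ?d ?e}"
  have w: "0 < n \<bullet> w" "point w \<in> H" if "w \<in> {?a, ?b, ?c, ?d, ?e}" for w
    using that s conv(2) by (elim insertE emptyE; simp)+
  have "?X = H"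
  proof (rule minimal)
    show "proj_convex ?X"
      by (rule proj_convex_cone[OF cone5_pos[OF w(1)] n(1) cone5_comb])
    have "point v \<in> ?X" if v: "v \<in> {a, b, c, d, e}" for v
    proof -
      have "s v *\<^sub>R v \<in> cone5 ?a ?b ?c ?d ?e" using v by (intro cone5_vertex) auto
      then show ?thesis using s(3)[OF v] by auto
    qed
    then show "?G \<subseteq> ?X" by simp
    show "?X \<subseteq> H"
    proof
      fix p assume "p \<in> ?X"
      then obtain v where v: "v \<in> reps p" "v \<in> cone5 ?a ?b ?c ?d ?e" by auto
      have "point v \<in> H"
        by (rule cone_subset_convex[OF conv(1) ne _ v(2) reps_nonzero[OF v(1)]]) (use w in blast)+
      then show "p \<in> H" using point_eq[OF v(1)] by simp
    qed
  qed
  moreover have "{s a, s b, s c, s d, s e} \<subseteq> {1, -1}" by (simp add: s_def)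
  ultimately show ?thesis using that[of "s a" "s b" "s c" "s d" "s e"] by simp
qed

lemma cone5_minus:
  assumes "v \<in> cone5 a b c d e"
  shows "- v \<in> cone5 (- a) (- b) (- c) (- d) (- e)"
proof -
  obtain x y z t u where v: "0 \<le> x" "0 \<le> y" "0 \<le> z" "0 \<le> t" "0 \<le> u"
    "v = x *\<^sub>R a + y *\<^sub>R b + z *\<^sub>R c + t *\<^sub>R d + u *\<^sub>R e" by (rule cone5E[OF assms])
  show ?thesis
    using cone5I[OF v(1-5), of "- a" "- b" "- c" "- d" "- e"] unfolding v(6) by simp
qed

text \<open>The products of any four signs are 1, so all five signs are equal.\<close>
lemma hull_on_frontier_eq_gon:
  assumes w: "pent a b c d e"
    and H: "proj_convex_hull {point a, point b, point c, point d, point e} H"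
    and fr: "{point a, point b, point c, point d, point e} \<subseteq> frontier H"
  shows "H = gon a b c d e"
proof -
  have nz: "0 \<notin> {a, b, c, d, e}" using pent_reps[OF w] reps_nonzero by blast
  obtain i j k l m where ijklm: "{i, j, k, l, m} \<subseteq> {1, -1 :: real}"
    and Heq: "H = {p. \<exists>v\<in>reps p. v \<in> cone5 (i *\<^sub>R a) (j *\<^sub>R b) (k *\<^sub>R c) (l *\<^sub>R d) (m *\<^sub>R e)}"
    by (rule hull_eq_cone[OF H nz])
  let ?C = "cone5 (i *\<^sub>R a) (j *\<^sub>R b) (k *\<^sub>R c) (l *\<^sub>R d) (m *\<^sub>R e)"
  have sg: "i \<in> {1, -1}" "j \<in> {1, -1}" "k \<in> {1, -1}" "l \<in> {1, -1}" "m \<in> {1, -1}"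
    using ijklm by simp_all
  have C: "i *\<^sub>R a \<in> ?C" "j *\<^sub>R b \<in> ?C" "k *\<^sub>R c \<in> ?C" "l *\<^sub>R d \<in> ?C" "m *\<^sub>R e \<in> ?C"
    by (rule cone5_vertex; simp)+
  have F: "point w \<in> frontier {p. \<exists>v\<in>reps p. v \<in> ?C}" if "w \<in> {a, b, c, d, e}" for w
    using fr that unfolding Heq by blast
  note D = w[unfolded pent_def]
  have "i * j * k * l = 1"
    by (rule four_signs[of a b c d, OF _ _ _ _ sg(1-4) C(1-4)]) (use D in simp_all, use F in blast)
  moreover have "i * j * k * m = 1"
    by (rule four_signs[of a b c e, OF _ _ _ _ sg(1-3,5) C(1-3,5)]) (use D in simp_all, use F in blast)
  moreover have "i * j * l * m = 1"
    by (rule four_signs[of a b d e, OF _ _ _ _ sg(1,2,4,5) C(1,2,4,5)]) (use D in simp_all, use F in blast)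
  moreover have "i * k * l * m = 1"
    by (rule four_signs[of a c d e, OF _ _ _ _ sg(1,3-5) C(1,3-5)]) (use D in simp_all, use F in blast)
  moreover have "j * k * l * m = 1"
    by (rule four_signs[of b c d e, OF _ _ _ _ sg(2-5) C(2-5)]) (use D in simp_all, use F in blast)
  ultimately consider "i = 1" "j = 1" "k = 1" "l = 1" "m = 1" | "i = -1" "j = -1" "k = -1" "l = -1" "m = -1"
    using sg by (elim insertE emptyE) simp_all
  then show ?thesis
  proof cases
    case 1
    then show ?thesis unfolding Heq gon_def using cone5_eq_pent_cl[OF w] by simp
  next
    case 2
    have "H = {p. \<exists>v\<in>reps p. v \<in> cone5 (- a) (- b) (- c) (- d) (- e)}" unfolding Heq using 2 by simp
    also have "\<dots> = {p. \<exists>v\<in>reps p. v \<in> cone5 a b c d e}"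
    proof (intro Collect_cong iffI)
      fix p assume "\<exists>v\<in>reps p. v \<in> cone5 (- a) (- b) (- c) (- d) (- e)"
      then obtain v where v: "v \<in> reps p" "v \<in> cone5 (- a) (- b) (- c) (- d) (- e)" by auto
      show "\<exists>v\<in>reps p. v \<in> cone5 a b c d e"
        by (rule bexI[OF _ reps_minus[OF v(1)]]) (use cone5_minus[OF v(2)] in simp)
    next
      fix p assume "\<exists>v\<in>reps p. v \<in> cone5 a b c d e"
      then obtain v where v: "v \<in> reps p" "v \<in> cone5 a b c d e" by auto
      show "\<exists>v\<in>reps p. v \<in> cone5 (- a) (- b) (- c) (- d) (- e)"
        by (rule bexI[OF _ reps_minus[OF v(1)]]) (use cone5_minus[OF v(2)] in simp)
    qed
    finally show ?thesis unfolding gon_def cone5_eq_pent_cl[OF w] by simp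
  qed
qed

section \<open>Holes of five, six and more points\<close>

lemma gon_hole:
  assumes w: "pent a b c d e" "{point a, point b, point c, point d, point e} \<subseteq> P"
    and empty: "\<And>v. v \<in> lifts P \<Longrightarrow> \<not> pent_int a b c d e v"
  shows "proj_hole 5 P (gon a b c d e)"
proof -
  let ?G = "{point a, point b, point c, point d, point e}"
  have "card ?G = 5" using pent_points_distinct[OF w(1)] by simp
  then have "proj_gon 5 P (gon a b c d e)"
    unfolding proj_gon_def using w(2) gon_hull[OF w(1)] gon_frontier[OF w(1)]
    by (intro exI[of _ ?G]) simp
  moreover have "P \<inter> interior (gon a b c d e) = {}"
    unfolding interior_gon[OF w(1)] using empty by (auto simp: lifts_def)
  ultimately show ?thesis by (simp add: proj_hole_def)
qed

text \<open>Stated for every convex position of the vertices, so that the pentagon can be described in the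
  most convenient way later on.\<close>
lemma hole_is_gon:
  assumes P: "general_position P" and h: "proj_hole 5 P H"
  obtains G where "G \<subseteq> P" "finite G" "card G = 5"
    "\<And>a b c d e. pent a b c d e \<Longrightarrow> G = {point a, point b, point c, point d, point e} \<Longrightarrow>
       H = gon a b c d e \<and> (\<forall>v\<in>lifts P. \<not> pent_int a b c d e v)"
proof -
  obtain G where G: "G \<subseteq> P" "finite G" "card G = 5" "proj_convex_hull G H" "G \<subseteq> frontier H"
    using h unfolding proj_hole_def proj_gon_def by blast
  have "H = gon a b c d e \<and> (\<forall>v\<in>lifts P. \<not> pent_int a b c d e v)"
    if w: "pent a b c d e" "G = {point a, point b, point c, point d, point e}" for a b c d e
  proof
    show eq: "H = gon a b c d e"
      by (rule hull_on_frontier_eq_gon[OF w(1)]) (use G w(2) in simp_all)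
    have "P \<inter> interior H = {}" using h unfolding proj_hole_def by blast
    then show "\<forall>v\<in>lifts P. \<not> pent_int a b c d e v"
      unfolding eq interior_gon[OF w(1)] lifts_def by blast
  qed
  then show ?thesis using that G by blast
qed

lemma five_points_one_hole:
  assumes P: "finite P" "card P = 5" "general_position P"
  shows "\<exists>H. {H. proj_hole 5 P H} = {H}"
proof -
  obtain a b c d e where w: "pent a b c d e" "P = {point a, point b, point c, point d, point e}"
    by (rule five_points_pent[OF P(3,1,2)])
  have "\<not> pent_int a b c d e v" if vP: "v \<in> lifts P" for v
  proof -
    obtain x where x: "x \<in> {a, b, c, d, e}" "v \<in> reps (point x)" using vP unfolding lifts_def w(2) by auto
    show ?thesis
      using x parallel_det[OF pent_reps[OF w(1) x(1)] x(2)] by (elim insertE emptyE) (simp_all add: pent_int_def)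
  qed
  then have "proj_hole 5 P (gon a b c d e)" by (intro gon_hole[OF w(1)]) (simp_all add: w(2))
  moreover have "H = gon a b c d e" if h: "proj_hole 5 P H" for H
  proof -
    obtain G where G: "G \<subseteq> P" "finite G" "card G = 5"
      "\<And>a b c d e. pent a b c d e \<Longrightarrow> G = {point a, point b, point c, point d, point e} \<Longrightarrow>
         H = gon a b c d e \<and> (\<forall>v\<in>lifts P. \<not> pent_int a b c d e v)"
      by (rule hole_is_gon[OF P(3) h]) blast
    have "G = P" using card_subset_eq[OF P(1) G(1)] G(3) P(2) by simp
    then show ?thesis using G(4)[OF w(1)] w(2) by blast
  qed
  ultimately show ?thesis by blast
qed

text \<open>Whichever of the six points is left out, the pentagon of the other five contains it.\<close>
lemma six_points_no_hole:
  assumes p: "pent p1 p2 p3 p4 p5" "pent_int p1 p2 p3 p4 p5 x" "pent_core p1 p2 p3 p4 p5 x"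
  defines "P \<equiv> {point p1, point p2, point p3, point p4, point p5, point x}"
  shows "general_position P" "card P = 6" "\<not> proj_hole 5 P H"
proof -
  note H = pentD[OF p(1)] pent_intD[OF p(2)] pent_coreD[OF p(3)]
  let ?V = "{p1, p2, p3, p4, p5, x}"
  have rep: "v \<in> reps (point v)" if "v \<in> ?V" for v
  proof (cases "v = x")
    case True
    have "x \<noteq> 0"
    proof
      assume "x = 0"
      then have "det3 p1 p2 x = 0" by (simp add: det3_def)
      then show False using p(2) by (simp add: pent_int_def)
    qed
    then show ?thesis unfolding True by (rule point_rep)
  next
    case False
    then show ?thesis using that by (intro pent_reps[OF p(1)]) simp
  qed
  have nz: "det3 u v w \<noteq> 0" if "u \<in> ?V" "v \<in> ?V" "w \<in> ?V" "distinct [u, v, w]" for u v w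
  proof -
    have "0 < det3 u v w \<or> 0 < det3 u w v"
      using that by (elim insertE emptyE) (simp_all add: H)
    moreover have "det3 u w v = - det3 u v w" by (simp add: det3_def algebra_simps)
    ultimately show ?thesis by auto
  qed
  show gp: "general_position P"
  proof (rule general_positionI)
    fix q r s assume P3: "q \<in> P" "r \<in> P" "s \<in> P" and d: "distinct [q, r, s]"
    have "\<exists>v\<in>?V. q = point v" if "q \<in> P" for q using that unfolding P_def by auto
    then obtain u v w where uvw: "u \<in> ?V" "v \<in> ?V" "w \<in> ?V" and q: "q = point u" "r = point v" "s = point w"
      using P3 by metis
    have "distinct [u, v, w]" using d q by auto
    then have "det3 u v w \<noteq> 0" by (rule nz[OF uvw])
    then show "\<exists>u\<in>reps q. \<exists>v\<in>reps r. \<exists>w\<in>reps s. det3 u v w \<noteq> 0"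
      unfolding q using rep[OF uvw(1)] rep[OF uvw(2)] rep[OF uvw(3)] by blast
  qed
  have "point x \<noteq> point v" if "v \<in> {p1, p2, p3, p4, p5}" for v
  proof
    assume "point x = point v"
    then have "x \<in> reps (point v)" using rep[of x] by simp
    note z = parallel_det[OF pent_reps[OF p(1) that] this]
    show False using that z H by (elim insertE emptyE) simp_all
  qed
  then have dist: "distinct [point p1, point p2, point p3, point p4, point p5, point x]"
    using pent_points_distinct[OF p(1)] by (simp add: eq_commute[of _ "point x"])
  then show card: "card P = 6" unfolding P_def by simp
  show "\<not> proj_hole 5 P H"
  proof
    assume "proj_hole 5 P H"
    then obtain G where G: "G \<subseteq> P" "finite G" "card G = 5"
      "\<And>a b c d e. pent a b c d e \<Longrightarrow> G = {point a, point b, point c, point d, point e} \<Longrightarrow>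
         H = gon a b c d e \<and> (\<forall>v\<in>lifts P. \<not> pent_int a b c d e v)"
      by (rule hole_is_gon[OF gp]) blast
    have V: "v \<in> lifts P" if "v \<in> ?V" for v using rep[OF that] that unfolding lifts_def P_def by auto
    have no: False if "pent a b c d e" "G = {point a, point b, point c, point d, point e}" "v \<in> ?V" "pent_int a b c d e v"
      for a b c d e v
      using G(4)[OF that(1,2)] V[OF that(3)] that(4) by blast
    have "card (P - G) = 1" using G card by (simp add: card_Diff_subset)
    then obtain g where g: "P - G = {g}" by (rule card_1_singletonE)
    then have Gg: "G = P - {g}" using G(1) by blast
    have "g \<in> P" using g by blast
    note q2 = pent_rotate[OF p(1)] pent_int_rotate[OF p(2)] pent_core_rotate[OF p(3)]
    note q3 = pent_rotate[OF q2(1)] pent_int_rotate[OF q2(2)] pent_core_rotate[OF q2(3)]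
    note q4 = pent_rotate[OF q3(1)] pent_int_rotate[OF q3(2)] pent_core_rotate[OF q3(3)]
    note q5 = pent_rotate[OF q4(1)] pent_int_rotate[OF q4(2)] pent_core_rotate[OF q4(3)]
    note a1 = pent_around[OF p] and a2 = pent_around[OF q2] and a3 = pent_around[OF q3]
      and a4 = pent_around[OF q4] and a5 = pent_around[OF q5]
    consider "g = point p1" | "g = point p2" | "g = point p3" | "g = point p4" | "g = point p5" | "g = point x"
      using \<open>g \<in> P\<close> unfolding P_def by blast
    then show False
    proof cases
      case 1
      show False by (rule no[OF a1(1) _ _ a1(2)]) (use Gg 1 dist in \<open>auto simp: P_def\<close>)
    next
      case 2
      show False by (rule no[OF a2(1) _ _ a2(2)]) (use Gg 2 dist in \<open>auto simp: P_def\<close>)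
    next
      case 3
      show False by (rule no[OF a3(1) _ _ a3(2)]) (use Gg 3 dist in \<open>auto simp: P_def\<close>)
    next
      case 4
      show False by (rule no[OF a4(1) _ _ a4(2)]) (use Gg 4 dist in \<open>auto simp: P_def\<close>)
    next
      case 5
      show False by (rule no[OF a5(1) _ _ a5(2)]) (use Gg 5 dist in \<open>auto simp: P_def\<close>)
    next
      case 6
      show False by (rule no[OF p(1) _ _ p(2)]) (use Gg 6 dist in \<open>auto simp: P_def\<close>)
    qed
  qed
qed

text \<open>A nearly regular pentagon with integer coordinates around its centre, in the plane of height 1.\<close>
lemma core_six_exists:
  obtains p1 p2 p3 p4 p5 x where "pent p1 p2 p3 p4 p5" "pent_int p1 p2 p3 p4 p5 x" "pent_core p1 p2 p3 p4 p5 x"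
proof
  let ?p1 = "vector [10, 0, 1] :: real ^ 3" and ?p2 = "vector [3, 9, 1] :: real ^ 3"
    and ?p3 = "vector [-8, 6, 1] :: real ^ 3" and ?p4 = "vector [-8, -6, 1] :: real ^ 3"
    and ?p5 = "vector [3, -9, 1] :: real ^ 3" and ?x = "vector [0, 0, 1] :: real ^ 3"
  show "pent ?p1 ?p2 ?p3 ?p4 ?p5" by (simp add: pent_def det3_def vector_3)
  show "pent_int ?p1 ?p2 ?p3 ?p4 ?p5 ?x" by (simp add: pent_int_def det3_def vector_3)
  show "pent_core ?p1 ?p2 ?p3 ?p4 ?p5 ?x" by (simp add: pent_core_def det3_def vector_3)
qed

theorem proposition4:
  "(\<forall>P. finite P \<and> card P \<ge> 7 \<and> general_position P \<longrightarrow> (\<exists>H. proj_hole 5 P H))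
   \<and> min_proj_holes 5 5 = 1 \<and> min_proj_holes 5 6 = 0"
proof (intro conjI allI impI)
  fix P :: "rp2 set" assume P: "finite P \<and> card P \<ge> 7 \<and> general_position P"
  then have "empty_pent (lifts P) (lifts P)" using seven_points_empty_pent by blast
  then obtain a b c d e where w: "{a, b, c, d, e} \<subseteq> lifts P" "pent a b c d e" "\<forall>v\<in>lifts P. \<not> pent_int a b c d e v"
    by (rule empty_pentE)
  have "{point a, point b, point c, point d, point e} \<subseteq> P" using w(1) lifts_reps by auto
  then show "\<exists>H. proj_hole 5 P H" using gon_hole[OF w(2)] w(3) by blast
next
  obtain p1 p2 p3 p4 p5 x where p: "pent p1 p2 p3 p4 p5" "pent_int p1 p2 p3 p4 p5 x" "pent_core p1 p2 p3 p4 p5 x"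
    by (rule core_six_exists)
  define P where "P = {point p1, point p2, point p3, point p4, point p5, point x}"
  note six = six_points_no_hole[OF p, folded P_def]
  let ?Q = "{point p1, point p2, point p3, point p4, point p5}"
  have Q: "finite ?Q" "card ?Q = 5" "general_position ?Q"
  proof -
    show "card ?Q = 5" using pent_points_distinct[OF p(1)] by simp
    show "general_position ?Q" by (rule general_position_subset[OF six(1)]) (auto simp: P_def)
  qed simp
  show "min_proj_holes 5 5 = 1"
    unfolding min_proj_holes_def
  proof (rule Least_equality)
    obtain H where "{H. proj_hole 5 ?Q H} = {H}" using five_points_one_hole[OF Q] by blast
    then have "finite {H. proj_hole 5 ?Q H} \<and> card {H. proj_hole 5 ?Q H} = 1" by simp
    then show "\<exists>P. finite P \<and> card P = 5 \<and> general_position P \<and>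
        finite {H. proj_hole 5 P H} \<and> card {H. proj_hole 5 P H} = 1" using Q by blast
  next
    fix m assume "\<exists>P. finite P \<and> card P = 5 \<and> general_position P \<and>
        finite {H. proj_hole 5 P H} \<and> card {H. proj_hole 5 P H} = m"
    then obtain P where P: "finite P" "card P = 5" "general_position P" "card {H. proj_hole 5 P H} = m" by blast
    obtain H where "{H. proj_hole 5 P H} = {H}" using five_points_one_hole[OF P(1-3)] by blast
    then show "1 \<le> m" using P(4) by simp
  qed
  have none: "{H. proj_hole 5 P H} = {}" using six(3) by blast
  show "min_proj_holes 5 6 = 0"
    unfolding min_proj_holes_def
  proof (rule Least_eq_0, intro exI conjI)
    show "finite P" by (simp add: P_def)
    show "card P = 6" "general_position P" by (rule six(2), rule six(1))
    show "finite {H. proj_hole 5 P H}" "card {H. proj_hole 5 P H} = 0" unfolding none by simp_all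
  qed
qed

end
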